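(* Let $\mathfrak A$ be a J-algebra or a relation algebra, and let $a,b\in A$ satisfy $$1'=a^{\smile};a=b^{\smile};b=a;a^{\smile}\cdot b;b^{\smile}\quad\text{and}\quad 1=a^{\smile};b=a;1=b;1.$$ Define the following elements of $\mathfrak A$: \begin{align*} K&=a,\qquad L=b,\qquad U=a^{\smile}\cdot b^{\smile},\qquad P=a;b^{\smile}\cdot b;a^{\smile},\qquad P_0=a;P;a^{\smile}\cdot b;b^{\smile},\\ A=R&=a;(a^{\smile})^2\cdot b;a;b^{\smile};a^{\smile}\cdot b^2;b^{\smile},\qquad R_0=a;R;a^{\smile}\cdot b;b^{\smile},\qquad B=a;a^{\smile}\cdot b;A;b^{\smile},\\ C&=a;(b^{\smile})^2\cdot b;a;a^{\smile}\cdot b^2;a^{\smile};b^{\smile},\qquad \pi_0=a;a^{\smile};b^{\smile}\cdot b;a;a^{\smile}\cdot b^2;(b^{\smile})^2 . \end{align*} Then: (i) $K$, $L$, $U$, $U^{\smile}$ are functional elements of $\mathfrak A$; (ii) $P$, $P_0$, $R$, $R_0$, $A$, $B$, $C$, $\pi_0$ are permutational elements of $\mathfrak A$; (iii) with $X_2=A;B;A^{\smile}$, $X_3=A^2;B;(A^{\smile})^2$, $C_2=B;C;A^{\smile}$, $C_3=B^2;C;(A^{\smile})^2$, $\pi_1=C_2;\pi_0;C_2^{\smile}$, $\pi_2=A;\pi_1;A^{\smile}$, $\pi_3=A^2;\pi_1;(A^{\smile})^2$ and $[X,Y]=X;Y;X^{\smile};Y^{\smile}$, the following fourteen relations hold in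 the group $\mathrm{Pm}(\mathfrak A)$: $[B^{\smile};A,X_2]=1'$, $[B^{\smile};A,X_3]=1'$, $C=C_2;B$, $X_2;C_2=C_3;B$, $A;C=C_2^2$, $C^3=1'$, $\pi_1^2=1'$, $\pi_3;\pi_1=\pi_1;\pi_3$, $(\pi_1;\pi_2)^3=1'$, $\pi_1;X_3=X_3;\pi_1$, $X_2;\pi_1=\pi_1;\pi_2;B$, $B;\pi_2=\pi_3;B$, $C_3;\pi_1=\pi_2;C_3$, $(C_2;\pi_1)^3=1'$; (iv) the subgroup of $\mathrm{Pm}(\mathfrak A)$ generated by $\{A,B\}$ is a homomorphic image of Thompson's group $\mathcal F$; (v) the subgroup of $\mathrm{Pm}(\mathfrak A)$ generated by $\{A,B,C\}$ is a homomorphic image of Thompson's group $\mathcal T$; (vi) the subgroup of $\mathrm{Pm}(\mathfrak A)$ generated by $\{A,B,C,\pi_0\}$ is a homomorphic image of Thompson's group $\mathcal V$; (vii) $\{P_0,R_0,K,U\}$ and $\{P,R,K,U\}$ generate the same submonoid of $\mathrm{Fn}(\mathfrak A)$; (viii) the relations for Thompson's monoid $\mathcal M$ hold in the monoid $\mathrm{Fn}(\mathfrak A)$, namely: $P;P=1'$, $(P;R)^3=(R;P)^3=1'$; and for all $x,y\in\mathrm{Fn}(\mathfrak A)$, writing $x_0=a;x;a^{\smile}\cdot b;b^{\smile}$ and $x_1=a;a^{\smile}\cdot b;x;b^{\smile}$: $x_0;y_1=y_1;x_0$, $x;U=U;x_0;x_1$, $x=U;x_0;x_1;K_0;L_1$;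 and $U;K=1'$, $U;L=1'$, $P_0;K;K=K;L$, $P_0;K;L=K;K$, $P_0;L=L$, $R_0;K;K;K=K;K$, $R_0;K;K;L=K;L;K$, $R_0;K;L=K;L;L$, $R_0;L=L$; (ix) the submonoid of $\mathrm{Fn}(\mathfrak A)$ generated by $\{P_0,R_0,K,U\}$ is a homomorphic image of Thompson's monoid $\mathcal M$.
   Context: A J-algebra is an algebra $\mathfrak A=\langle A,\cdot,0,1,;,{}^{\smile},1'\rangle$ with binary operations $\cdot$ (Boolean product) and $;$ (relative product), a unary operation ${}^{\smile}$ (converse) and constants $0,1,1'$, satisfying for all $x,y,z$: $x\cdot(y\cdot z)=(x\cdot y)\cdot z$, $x\cdot y=y\cdot x$, $x\cdot x=x$, $x;(y;z)=(x;y);z$, $x;1'=x$, $(x\cdot y);z=(x\cdot y);z\cdot y;z$, $x^{\smile\smile}=x$, $(x;y)^{\smile}=y^{\smile};x^{\smile}$, $(x\cdot y)^{\smile}=x^{\smile}\cdot y^{\smile}$, $x;y\cdot z=(z;y^{\smile}\cdot x);(y\cdot x^{\smile};z)\cdot z$, $0\cdot x=0$, $x\cdot 1=x$, $x;0=0$. Converse binds tightest, then $;$, then $\cdot$; $x^n$ is the $n$-fold relative product. $x\le y$ means $x\cdot y=x$. A relation algebra (Tarski) is an algebra $\langle A,+,\cdot,-,0,1,;,{}^{\smile},1'\rangle$ satisfying: $+$ commutative and associative, $-(-x+-y)+-(-x+y)=x$, $x;(y;z)=(x;y);z$, $(x+y);z=x;z+y;z$, $x;1'=x$, $x^{\smile\smile}=x$,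 $(x+y)^{\smile}=x^{\smile}+y^{\smile}$, $(x;y)^{\smile}=y^{\smile};x^{\smile}$, $x^{\smile};-(x;y)+-y=-y$, $x\cdot y=-(-x+-y)$, $1=1'+-1'$, $0=-1$. An element $x$ is functional if $x^{\smile};x\le 1'$ and permutational if $x;x^{\smile}=1'=x^{\smile};x$; $\mathrm{Fn}(\mathfrak A)=\langle\text{functional elements},;,1'\rangle$ is a monoid and $\mathrm{Pm}(\mathfrak A)=\langle\text{permutational elements},;,{}^{\smile},1'\rangle$ is a group. Thompson's groups are defined by presentations (group notation, juxtaposition = composition of functions): put $X_2=A^{-1}BA$, $X_3=A^{-2}BA^2$, $C_2=A^{-1}CB$, $C_3=A^{-2}CB^2$, $\pi_1=C_2^{-1}\pi_0C_2$, $\pi_2=A^{-1}\pi_1A$, $\pi_3=A^{-2}\pi_1A^2$, and consider relations (1) $[AB^{-1},X_2]=1$, (2) $[AB^{-1},X_3]=1$, (3) $C=BC_2$, (4) $C_2X_2=BC_3$, (5) $CA=C_2^2$, (6) $C^3=1$, (7) $\pi_1^2=1$, (8) $\pi_1\pi_3=\pi_3\pi_1$, (9) $(\pi_2\pi_1)^3=1$, (10) $X_3\pi_1=\pi_1X_3$, (11) $\pi_1X_2=B\pi_2\pi_1$, (12) $\pi_2B=B\pi_3$, (13) $\pi_1C_3=C_3\pi_2$, (14) $(\pi_1C_2)^3=1$. $\mathcal F$ is the group with generators $A,B$ and relations (1),(2); $\mathcal T$ has generators $A,B,C$ and relations (1)–(6); $\mathcal V$ has generators $A,B,C,\pi_0$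 and relations (1)–(14). Thompson's monoid $\mathcal M$ is the monoid (Thompson; Brin) generated by $K,L,U,P_0,R_0$ (with $P,R$ elements of it) whose defining relations are those listed in (viii) (composition read left to right), with $x,y$ ranging over all elements of $\mathcal M$ and $x_0,x_1$ the corresponding "deferments" of $x$. *)

theory Defs
  imports "HOL-Algebra.Generated_Groups"
begin

record 'a j_alg = "'a partial_object" +
  bprod :: "'a \<Rightarrow> 'a \<Rightarrow> 'a"  (infixl \<open>\<cdot>\<index>\<close> 70)
  bzero :: 'a  (\<open>\<^bold>0\<index>\<close>)
  bone  :: 'a  (\<open>\<^bold>1\<index>\<close>)
  rprod :: "'a \<Rightarrow> 'a \<Rightarrow> 'a"  (infixl \<open>\<Zcomp>\<index>\<close> 75)
  rconv :: "'a \<Rightarrow> 'a"  (\<open>(_\<^sup>\<smile>\<index>)\<close> [1000] 1000)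
  rid   :: 'a  (\<open>\<^bold>1''\<index>\<close>)

locale j_algebra =
  fixes \<AA> :: "('a, 'm) j_alg_scheme" (structure)
  assumes bprod_closed: "x \<in> carrier \<AA> \<Longrightarrow> y \<in> carrier \<AA> \<Longrightarrow> x \<cdot> y \<in> carrier \<AA>"
    and bzero_closed: "\<^bold>0 \<in> carrier \<AA>"
    and bone_closed: "\<^bold>1 \<in> carrier \<AA>"
    and rprod_closed: "x \<in> carrier \<AA> \<Longrightarrow> y \<in> carrier \<AA> \<Longrightarrow> x \<Zcomp> y \<in> carrier \<AA>"
    and rconv_closed: "x \<in> carrier \<AA> \<Longrightarrow> x\<^sup>\<smile> \<in> carrier \<AA>"
    and rid_closed: "\<^bold>1' \<in> carrier \<AA>"
    and bprod_assoc: "\<lbrakk>x \<in> carrier \<AA>; y \<in> carrier \<AA>; z \<in> carrier \<AA>\<rbrakk>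
          \<Longrightarrow> x \<cdot> (y \<cdot> z) = (x \<cdot> y) \<cdot> z"
    and bprod_comm: "\<lbrakk>x \<in> carrier \<AA>; y \<in> carrier \<AA>\<rbrakk> \<Longrightarrow> x \<cdot> y = y \<cdot> x"
    and bprod_idem: "x \<in> carrier \<AA> \<Longrightarrow> x \<cdot> x = x"
    and rprod_assoc: "\<lbrakk>x \<in> carrier \<AA>; y \<in> carrier \<AA>; z \<in> carrier \<AA>\<rbrakk>
          \<Longrightarrow> x \<Zcomp> (y \<Zcomp> z) = (x \<Zcomp> y) \<Zcomp> z"
    and rprod_rid: "x \<in> carrier \<AA> \<Longrightarrow> x \<Zcomp> \<^bold>1' = x"
    and rprod_mono: "\<lbrakk>x \<in> carrier \<AA>; y \<in> carrier \<AA>; z \<in> carrier \<AA>\<rbrakk>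
          \<Longrightarrow> (x \<cdot> y) \<Zcomp> z = (x \<cdot> y) \<Zcomp> z \<cdot> y \<Zcomp> z"
    and rconv_rconv: "x \<in> carrier \<AA> \<Longrightarrow> x\<^sup>\<smile>\<^sup>\<smile> = x"
    and rconv_rprod: "\<lbrakk>x \<in> carrier \<AA>; y \<in> carrier \<AA>\<rbrakk> \<Longrightarrow> (x \<Zcomp> y)\<^sup>\<smile> = y\<^sup>\<smile> \<Zcomp> x\<^sup>\<smile>"
    and rconv_bprod: "\<lbrakk>x \<in> carrier \<AA>; y \<in> carrier \<AA>\<rbrakk> \<Longrightarrow> (x \<cdot> y)\<^sup>\<smile> = x\<^sup>\<smile> \<cdot> y\<^sup>\<smile>"
    and rotation: "\<lbrakk>x \<in> carrier \<AA>; y \<in> carrier \<AA>; z \<in> carrier \<AA>\<rbrakk>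
          \<Longrightarrow> x \<Zcomp> y \<cdot> z = (z \<Zcomp> y\<^sup>\<smile> \<cdot> x) \<Zcomp> (y \<cdot> x\<^sup>\<smile> \<Zcomp> z) \<cdot> z"
    and bzero_bprod: "x \<in> carrier \<AA> \<Longrightarrow> \<^bold>0 \<cdot> x = \<^bold>0"
    and bprod_bone: "x \<in> carrier \<AA> \<Longrightarrow> x \<cdot> \<^bold>1 = x"
    and rprod_bzero: "x \<in> carrier \<AA> \<Longrightarrow> x \<Zcomp> \<^bold>0 = \<^bold>0"

text \<open>The operations of a relation algebra that are absent from the signature of J-algebras,
  Boolean sum and complement, are separate parameters.\<close>

locale relation_algebra =
  fixes \<AA> :: "('a, 'm) j_alg_scheme" (structure)
    and bsum :: "'a \<Rightarrow> 'a \<Rightarrow> 'a"  (infixl \<open>\<^bold>+\<close> 65)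
    and bcompl :: "'a \<Rightarrow> 'a"  (\<open>\<sim>_\<close> [81] 80)
  assumes bsum_closed: "x \<in> carrier \<AA> \<Longrightarrow> y \<in> carrier \<AA> \<Longrightarrow> x \<^bold>+ y \<in> carrier \<AA>"
    and bprod_closed: "x \<in> carrier \<AA> \<Longrightarrow> y \<in> carrier \<AA> \<Longrightarrow> x \<cdot> y \<in> carrier \<AA>"
    and bcompl_closed: "x \<in> carrier \<AA> \<Longrightarrow> \<sim>x \<in> carrier \<AA>"
    and bzero_closed: "\<^bold>0 \<in> carrier \<AA>"
    and bone_closed: "\<^bold>1 \<in> carrier \<AA>"
    and rprod_closed: "x \<in> carrier \<AA> \<Longrightarrow> y \<in> carrier \<AA> \<Longrightarrow> x \<Zcomp> y \<in> carrier \<AA>"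
    and rconv_closed: "x \<in> carrier \<AA> \<Longrightarrow> x\<^sup>\<smile> \<in> carrier \<AA>"
    and rid_closed: "\<^bold>1' \<in> carrier \<AA>"
    and bsum_comm: "\<lbrakk>x \<in> carrier \<AA>; y \<in> carrier \<AA>\<rbrakk> \<Longrightarrow> x \<^bold>+ y = y \<^bold>+ x"
    and bsum_assoc: "\<lbrakk>x \<in> carrier \<AA>; y \<in> carrier \<AA>; z \<in> carrier \<AA>\<rbrakk>
          \<Longrightarrow> x \<^bold>+ (y \<^bold>+ z) = (x \<^bold>+ y) \<^bold>+ z"
    and huntington: "\<lbrakk>x \<in> carrier \<AA>; y \<in> carrier \<AA>\<rbrakk>
          \<Longrightarrow> \<sim>(\<sim>x \<^bold>+ \<sim>y) \<^bold>+ \<sim>(\<sim>x \<^bold>+ y) = x"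
    and rprod_assoc: "\<lbrakk>x \<in> carrier \<AA>; y \<in> carrier \<AA>; z \<in> carrier \<AA>\<rbrakk>
          \<Longrightarrow> x \<Zcomp> (y \<Zcomp> z) = (x \<Zcomp> y) \<Zcomp> z"
    and rprod_bsum: "\<lbrakk>x \<in> carrier \<AA>; y \<in> carrier \<AA>; z \<in> carrier \<AA>\<rbrakk>
          \<Longrightarrow> (x \<^bold>+ y) \<Zcomp> z = x \<Zcomp> z \<^bold>+ y \<Zcomp> z"
    and rprod_rid: "x \<in> carrier \<AA> \<Longrightarrow> x \<Zcomp> \<^bold>1' = x"
    and rconv_rconv: "x \<in> carrier \<AA> \<Longrightarrow> x\<^sup>\<smile>\<^sup>\<smile> = x"
    and rconv_bsum: "\<lbrakk>x \<in> carrier \<AA>; y \<in> carrier \<AA>\<rbrakk> \<Longrightarrow> (x \<^bold>+ y)\<^sup>\<smile> = x\<^sup>\<smile> \<^bold>+ y\<^sup>\<smile>"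
    and rconv_rprod: "\<lbrakk>x \<in> carrier \<AA>; y \<in> carrier \<AA>\<rbrakk> \<Longrightarrow> (x \<Zcomp> y)\<^sup>\<smile> = y\<^sup>\<smile> \<Zcomp> x\<^sup>\<smile>"
    and tarski: "\<lbrakk>x \<in> carrier \<AA>; y \<in> carrier \<AA>\<rbrakk>
          \<Longrightarrow> x\<^sup>\<smile> \<Zcomp> \<sim>(x \<Zcomp> y) \<^bold>+ \<sim>y = \<sim>y"
    and bprod_eq: "\<lbrakk>x \<in> carrier \<AA>; y \<in> carrier \<AA>\<rbrakk> \<Longrightarrow> x \<cdot> y = \<sim>(\<sim>x \<^bold>+ \<sim>y)"
    and bone_eq: "\<^bold>1 = \<^bold>1' \<^bold>+ \<sim>\<^bold>1'"
    and bzero_eq: "\<^bold>0 = \<sim>\<^bold>1"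

definition rle :: "('a, 'm) j_alg_scheme \<Rightarrow> 'a \<Rightarrow> 'a \<Rightarrow> bool"  (infix \<open>\<preceq>\<index>\<close> 50)
  where "x \<preceq>\<^bsub>\<AA>\<^esub> y \<longleftrightarrow> x \<cdot>\<^bsub>\<AA>\<^esub> y = x"

definition functional :: "('a, 'm) j_alg_scheme \<Rightarrow> 'a \<Rightarrow> bool"
  where "functional \<AA> x \<longleftrightarrow> x \<in> carrier \<AA> \<and> x\<^sup>\<smile>\<^bsub>\<AA>\<^esub> \<Zcomp>\<^bsub>\<AA>\<^esub> x \<preceq>\<^bsub>\<AA>\<^esub> \<^bold>1'\<^bsub>\<AA>\<^esub>"

definition permutational :: "('a, 'm) j_alg_scheme \<Rightarrow> 'a \<Rightarrow> bool"
  where "permutational \<AA> x \<longleftrightarrow> x \<in> carrier \<AA> \<and>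
    x \<Zcomp>\<^bsub>\<AA>\<^esub> x\<^sup>\<smile>\<^bsub>\<AA>\<^esub> = \<^bold>1'\<^bsub>\<AA>\<^esub> \<and> x\<^sup>\<smile>\<^bsub>\<AA>\<^esub> \<Zcomp>\<^bsub>\<AA>\<^esub> x = \<^bold>1'\<^bsub>\<AA>\<^esub>"

definition Fn :: "('a, 'm) j_alg_scheme \<Rightarrow> 'a monoid"
  where "Fn \<AA> = \<lparr>carrier = {x. functional \<AA> x}, mult = rprod \<AA>, one = rid \<AA>\<rparr>"

definition Pm :: "('a, 'm) j_alg_scheme \<Rightarrow> 'a monoid"
  where "Pm \<AA> = \<lparr>carrier = {x. permutational \<AA> x}, mult = rprod \<AA>, one = rid \<AA>\<rparr>"

definition submonoid_generated :: "('a, 'b) monoid_scheme \<Rightarrow> 'a set \<Rightarrow> ('a, 'b) monoid_scheme"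
  where "submonoid_generated G S =
    G\<lparr>carrier := \<Inter>{H. submonoid H G \<and> carrier G \<inter> S \<subseteq> H}\<rparr>"

definition group_image :: "('a, 'b) monoid_scheme \<Rightarrow> ('c, 'd) monoid_scheme \<Rightarrow> bool"
  where "group_image H G \<longleftrightarrow> (\<exists>h. h \<in> epi G H)"

definition monoid_image :: "('a, 'b) monoid_scheme \<Rightarrow> ('c, 'd) monoid_scheme \<Rightarrow> bool"
  where "monoid_image H G \<longleftrightarrow> (\<exists>h. h \<in> epi G H \<and> h \<one>\<^bsub>G\<^esub> = \<one>\<^bsub>H\<^esub>)"

inductive pcong :: "'l set \<Rightarrow> ('l list \<times> 'l list) set \<Rightarrow> 'l list \<Rightarrow> 'l list \<Rightarrow> bool"
  for S :: "'l set" and R :: "('l list \<times> 'l list) set"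
  where
    cong_rel: "(u, v) \<in> R \<Longrightarrow> pcong S R u v"
  | cong_refl: "u \<in> lists S \<Longrightarrow> pcong S R u u"
  | cong_sym: "pcong S R u v \<Longrightarrow> pcong S R v u"
  | cong_trans: "pcong S R u v \<Longrightarrow> pcong S R v w \<Longrightarrow> pcong S R u w"
  | cong_app: "pcong S R u u' \<Longrightarrow> pcong S R v v' \<Longrightarrow> pcong S R (u @ v) (u' @ v')"

definition presented_monoid :: "'l set \<Rightarrow> ('l list \<times> 'l list) set \<Rightarrow> 'l list set monoid"
  where "presented_monoid S R =
    \<lparr>carrier = lists S // {(u, v). pcong S R u v},
     mult = (\<lambda>X Y. \<Union>u\<in>X. \<Union>v\<in>Y. {w. pcong S R (u @ v) w}),
     one = {w. pcong S R [] w}\<rparr>"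

text \<open>Letters \<open>(g, True)\<close> and \<open>(g, False)\<close> stand for a generator \<open>g\<close> and its inverse.\<close>

definition presented_group ::
    "'g set \<Rightarrow> (('g \<times> bool) list \<times> ('g \<times> bool) list) set \<Rightarrow> ('g \<times> bool) list set monoid"
  where "presented_group S R = presented_monoid (S \<times> UNIV)
    (R \<union> {([(g, e), (g, \<not> e)], []) | g e. g \<in> S})"

definition winv :: "('g \<times> bool) list \<Rightarrow> ('g \<times> bool) list"
  where "winv w = rev (map (\<lambda>(g, e). (g, \<not> e)) w)"

definition wcomm :: "('g \<times> bool) list \<Rightarrow> ('g \<times> bool) list \<Rightarrow> ('g \<times> bool) list"
  where "wcomm v w = v @ w @ winv v @ winv w"

datatype tgen = GA | GB | GC | GPi

definition "wA = [(GA, True)]"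
definition "wB = [(GB, True)]"
definition "wC = [(GC, True)]"
definition "wPi0 = [(GPi, True)]"
definition "wX2 = winv wA @ wB @ wA"
definition "wX3 = winv wA @ winv wA @ wB @ wA @ wA"
definition "wC2 = winv wA @ wC @ wB"
definition "wC3 = winv wA @ winv wA @ wC @ wB @ wB"
definition "wPi1 = winv wC2 @ wPi0 @ wC2"
definition "wPi2 = winv wA @ wPi1 @ wA"
definition "wPi3 = winv wA @ winv wA @ wPi1 @ wA @ wA"

definition F_relations :: "((tgen \<times> bool) list \<times> (tgen \<times> bool) list) set"
  where "F_relations =
    {(wcomm (wA @ winv wB) wX2, []),
     (wcomm (wA @ winv wB) wX3, [])}"

definition T_relations :: "((tgen \<times> bool) list \<times> (tgen \<times> bool) list) set"
  where "T_relations = F_relations \<union>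
    {(wC, wB @ wC2),
     (wC2 @ wX2, wB @ wC3),
     (wC @ wA, wC2 @ wC2),
     (wC @ wC @ wC, [])}"

definition V_relations :: "((tgen \<times> bool) list \<times> (tgen \<times> bool) list) set"
  where "V_relations = T_relations \<union>
    {(wPi1 @ wPi1, []),
     (wPi1 @ wPi3, wPi3 @ wPi1),
     ((wPi2 @ wPi1) @ (wPi2 @ wPi1) @ (wPi2 @ wPi1), []),
     (wX3 @ wPi1, wPi1 @ wX3),
     (wPi1 @ wX2, wB @ wPi2 @ wPi1),
     (wPi2 @ wB, wB @ wPi3),
     (wPi1 @ wC3, wC3 @ wPi2),
     ((wPi1 @ wC2) @ (wPi1 @ wC2) @ (wPi1 @ wC2), [])}"

definition "thompson_F = presented_group {GA, GB} F_relations"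
definition "thompson_T = presented_group {GA, GB, GC} T_relations"
definition "thompson_V = presented_group {GA, GB, GC, GPi} V_relations"

datatype mgen = gK | gL | gU | gP0 | gR0

definition mP :: "mgen list" where "mP = [gU, gP0, gK]"
definition mR :: "mgen list" where "mR = [gU, gR0, gK]"

text \<open>The inverse of \<open>R\<close>, by \<open>P\<^sup>2 = (PR)\<^sup>3 = (RP)\<^sup>3 = 1\<close>.\<close>

definition mRi :: "mgen list" where "mRi = mP @ mR @ mP @ mR @ mP"

text \<open>With \<open>K\<close> and \<open>L\<close> read as the two projections, the deferments of \<open>x\<close> are \<open>x\<close> acting on one
  coordinate: \<open>x\<^sub>0K = Kx\<close>, \<open>x\<^sub>0L = L\<close>, \<open>x\<^sub>1K = K\<close>, \<open>x\<^sub>1L = Lx\<close>.  They are compositional and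
  \<open>x\<^sub>1 = Px\<^sub>0P\<close>, so only \<open>x\<^sub>0\<close> for the five generators has to be written as a word.  For example,
  \<open>U\<^sub>0 = UK\<^sub>0R\<close> takes \<open>(p, q)\<close> via \<open>((p, q), (p, q))\<close> and \<open>(p, (p, q))\<close> to \<open>((p, p), q)\<close>.  The lemmas at
  the end of the theory show that in the monoid these words satisfy the four laws, that the laws
  determine them, and that the deferments of \<open>P\<close> and \<open>R\<close> are the generators \<open>P\<^sub>0\<close> and \<open>R\<^sub>0\<close>.\<close>

definition mK0 :: "mgen list" where "mK0 = mRi @ mP @ mRi @ [gL] @ mP"

fun gdefer0 :: "mgen \<Rightarrow> mgen list" where
  "gdefer0 gK = mK0"
| "gdefer0 gL = mRi @ [gL]"
| "gdefer0 gU = [gU] @ mK0 @ mR"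
| "gdefer0 gP0 = mRi @ [gP0] @ mR"
| "gdefer0 gR0 = mRi @ [gR0] @ mR"

definition defer0 :: "mgen list \<Rightarrow> mgen list" where "defer0 w = concat (map gdefer0 w)"
definition defer1 :: "mgen list \<Rightarrow> mgen list" where "defer1 w = mP @ defer0 w @ mP"

definition M_schemes :: "(mgen list \<times> mgen list) set"
  where "M_schemes =
    {(mP @ mP, []),
     ((mP @ mR) @ (mP @ mR) @ (mP @ mR), []),
     ((mR @ mP) @ (mR @ mP) @ (mR @ mP), [])} \<union>
    {(defer0 x @ defer1 y, defer1 y @ defer0 x) | x y. True} \<union>
    {(x @ [gU], [gU] @ defer0 x @ defer1 x) | x. True} \<union>
    {(x, [gU] @ defer0 x @ defer1 x @ defer0 [gK] @ defer1 [gL]) | x. True} \<union>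
    {([gU, gK], []),
     ([gU, gL], []),
     ([gP0, gK, gK], [gK, gL]),
     ([gP0, gK, gL], [gK, gK]),
     ([gP0, gL], [gL]),
     ([gR0, gK, gK, gK], [gK, gK]),
     ([gR0, gK, gK, gL], [gK, gL, gK]),
     ([gR0, gK, gL], [gK, gL, gL]),
     ([gR0, gL], [gL])}"

text \<open>The deferments are operations on the elements of the monoid, hence must agree on words that
  represent the same element: the relations are closed under deferment.\<close>

inductive_set M_relations :: "(mgen list \<times> mgen list) set" where
  scheme: "r \<in> M_schemes \<Longrightarrow> r \<in> M_relations"
| deferred: "(u, v) \<in> M_relations \<Longrightarrow> (defer0 u, defer0 v) \<in> M_relations"

definition "thompson_M = presented_monoid UNIV M_relations"

abbreviation mcong :: "mgen list \<Rightarrow> mgen list \<Rightarrow> bool"  (infix \<open>\<approx>\<close> 50)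
  where "u \<approx> v \<equiv> pcong UNIV M_relations u v"

context
begin

private lemma mrefl: "u \<approx> u"
  by (simp add: pcong.cong_refl)

private lemma scheme_cong: "(u, v) \<in> M_schemes \<Longrightarrow> u \<approx> v"
  by (intro pcong.cong_rel M_relations.scheme)

private lemma cong_left: "u \<approx> u' \<Longrightarrow> u @ v \<approx> u' @ v"
  by (intro pcong.cong_app mrefl)

private lemma cong_right: "v \<approx> v' \<Longrightarrow> u @ v \<approx> u @ v'"
  by (intro pcong.cong_app mrefl)

private lemma defer0_app: "defer0 (u @ v) = defer0 u @ defer0 v"
  by (simp add: defer0_def)

lemma defer0_cong: "u \<approx> v \<Longrightarrow> defer0 u \<approx> defer0 v"
proof (induction rule: pcong.induct)
  case (cong_rel u v)
  then show ?case by (intro pcong.cong_rel M_relations.deferred)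
next
  case (cong_app u u' v v')
  then show ?case by (simp add: defer0_app pcong.cong_app)
qed (auto intro: mrefl pcong.cong_sym pcong.cong_trans)

lemma defer1_cong: "u \<approx> v \<Longrightarrow> defer1 u \<approx> defer1 v"
  unfolding defer1_def by (rule cong_right[OF cong_left[OF defer0_cong]])

private definition cls :: "mgen list \<Rightarrow> mgen list set" where "cls u = {v. u \<approx> v}"

private lemma cls_eq: "cls u = cls v \<longleftrightarrow> u \<approx> v"
  unfolding cls_def using mrefl pcong.cong_sym pcong.cong_trans by blast

private definition act :: "mgen list \<Rightarrow> mgen list set \<Rightarrow> mgen list set"
  where "act u X = (\<Union>v\<in>X. cls (u @ v))"

private lemma act_cls: "act u (cls v) = cls (u @ v)"
proof -
  have "cls (u @ w) = cls (u @ v)" if "w \<in> cls v" for w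
    using that unfolding cls_eq by (auto simp: cls_def intro: cong_right pcong.cong_sym)
  moreover have "v \<in> cls v" by (simp add: cls_def mrefl)
  ultimately show ?thesis unfolding act_def by blast
qed

private lemma schemeI: "(u, v) \<in> M_schemes \<Longrightarrow> cls (u @ p) = cls (v @ p)"
  unfolding cls_eq by (intro cong_left scheme_cong)

private lemma act_append: "act (u @ v) (cls w) = act u (act v (cls w))"
  by (simp add: act_cls)

private lemma gen_steps:
  "cls (gU # gK # p) = cls p"
  "cls (gU # gL # p) = cls p"
  "cls (gP0 # gK # gK # p) = cls (gK # gL # p)"
  "cls (gP0 # gK # gL # p) = cls (gK # gK # p)"
  "cls (gP0 # gL # p) = cls (gL # p)"
  "cls (gR0 # gK # gK # gK # p) = cls (gK # gK # p)"
  "cls (gR0 # gK # gK # gL # p) = cls (gK # gL # gK # p)"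
  "cls (gR0 # gK # gL # p) = cls (gK # gL # gL # p)"
  "cls (gR0 # gL # p) = cls (gL # p)"
  using schemeI[of "[gU, gK]" "[]" p] schemeI[of "[gU, gL]" "[]" p]
    schemeI[of "[gP0, gK, gK]" "[gK, gL]" p] schemeI[of "[gP0, gK, gL]" "[gK, gK]" p]
    schemeI[of "[gP0, gL]" "[gL]" p]
    schemeI[of "[gR0, gK, gK, gK]" "[gK, gK]" p] schemeI[of "[gR0, gK, gK, gL]" "[gK, gL, gK]" p]
    schemeI[of "[gR0, gK, gL]" "[gK, gL, gL]" p] schemeI[of "[gR0, gL]" "[gL]" p]
  by (simp_all add: M_schemes_def)

private lemma cong_in: "cls v = cls v' \<Longrightarrow> cls (u @ v) = cls (u @ v')"
  unfolding cls_eq by (rule cong_right)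

private lemma PR_steps:
  "cls (mP @ gK # p) = cls (gL # p)"
  "cls (mP @ gL # p) = cls (gK # p)"
  "cls (mR @ gK # gK # p) = cls (gK # p)"
  "cls (mR @ gK # gL # p) = cls (gL # gK # p)"
  "cls (mR @ gL # p) = cls (gL # gL # p)"
  using cong_in[of "gP0 # gK # gK # p" "gK # gL # p" "[gU]"]
    cong_in[of "gP0 # gK # gL # p" "gK # gK # p" "[gU]"]
    cong_in[of "gR0 # gK # gK # gK # p" "gK # gK # p" "[gU]"]
    cong_in[of "gR0 # gK # gK # gL # p" "gK # gL # gK # p" "[gU]"]
    cong_in[of "gR0 # gK # gL # p" "gK # gL # gL # p" "[gU]"]
  by (simp_all add: mP_def mR_def gen_steps)

private lemma PP: "cls (mP @ mP @ p) = cls p"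
  using schemeI[of "mP @ mP" "[]" p] by (simp add: M_schemes_def)

private lemma RiR: "cls (mRi @ mR @ p) = cls p"
  using schemeI[of "(mP @ mR) @ (mP @ mR) @ (mP @ mR)" "[]" p]
  by (simp add: M_schemes_def mRi_def)

private lemma Ri_steps:
  "cls (mRi @ gK # p) = cls (gK # gK # p)"
  "cls (mRi @ gL # gK # p) = cls (gK # gL # p)"
  "cls (mRi @ gL # gL # p) = cls (gL # p)"
  using cong_in[OF PR_steps(3), of mRi p] cong_in[OF PR_steps(4), of mRi p]
    cong_in[OF PR_steps(5), of mRi p]
  by (simp_all add: RiR)

private lemma defer1_app: "defer1 (u @ v) \<approx> defer1 u @ defer1 v"
  using cong_in[OF PP[symmetric], of "mP @ defer0 u" "defer0 v @ mP"]
  by (simp add: defer1_def defer0_app cls_eq)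

private lemma pairing: "z \<approx> [gU] @ defer0 (z @ [gK]) @ defer1 (z @ [gL])"
proof -
  have "(z, [gU] @ defer0 z @ defer1 z @ defer0 [gK] @ defer1 [gL]) \<in> M_schemes"
    unfolding M_schemes_def by (intro UnI1[OF UnI2] CollectI exI[of _ z] conjI refl TrueI)
  then have 1: "z \<approx> [gU] @ defer0 z @ (defer1 z @ defer0 [gK]) @ defer1 [gL]"
    unfolding append_assoc by (rule scheme_cong)
  have "(defer0 [gK] @ defer1 z, defer1 z @ defer0 [gK]) \<in> M_schemes"
    unfolding M_schemes_def by (intro UnI1[OF UnI1[OF UnI1[OF UnI2]]] CollectI exI[of _ "[gK]"] exI[of _ z]
        conjI refl TrueI)
  then have "defer0 [gK] @ defer1 z \<approx> defer1 z @ defer0 [gK]"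
    by (rule scheme_cong)
  then have "[gU] @ defer0 z @ (defer1 z @ defer0 [gK]) @ defer1 [gL] \<approx>
      [gU] @ defer0 z @ (defer0 [gK] @ defer1 z) @ defer1 [gL]"
    by (rule cong_right[OF cong_right[OF cong_left[OF pcong.cong_sym]]])
  from pcong.cong_trans[OF 1 this]
  have 2: "z \<approx> ([gU] @ defer0 (z @ [gK])) @ (defer1 z @ defer1 [gL])"
    by (simp add: defer0_app)
  have "([gU] @ defer0 (z @ [gK])) @ (defer1 z @ defer1 [gL]) \<approx>
      ([gU] @ defer0 (z @ [gK])) @ defer1 (z @ [gL])"
    by (rule cong_right[OF pcong.cong_sym[OF defer1_app]])
  from pcong.cong_trans[OF 2 this] show ?thesis by simp
qed

lemma projections_determine:
  assumes "z @ [gK] \<approx> z' @ [gK]" "z @ [gL] \<approx> z' @ [gL]"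
  shows "z \<approx> z'"
proof -
  have "[gU] @ defer0 (z @ [gK]) @ defer1 (z @ [gL]) \<approx>
      [gU] @ defer0 (z' @ [gK]) @ defer1 (z' @ [gL])"
    by (rule pcong.cong_app[OF mrefl pcong.cong_app[OF defer0_cong[OF assms(1)] defer1_cong[OF assms(2)]]])
  then show ?thesis using pairing pcong.cong_sym pcong.cong_trans by metis
qed

private lemma ext:
  assumes "cls (z @ [gK]) = cls (z' @ [gK])" "cls (z @ [gL]) = cls (z' @ [gL])"
  shows "cls z = cls z'"
  using assms projections_determine unfolding cls_eq by blast

private lemmas acts = gen_steps PR_steps Ri_steps

private lemma act_steps:
  "act [gU] (cls (gK # p)) = cls p"
  "act [gU] (cls (gL # p)) = cls p"
  "act [gP0] (cls (gK # gK # p)) = cls (gK # gL # p)"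
  "act [gP0] (cls (gK # gL # p)) = cls (gK # gK # p)"
  "act [gP0] (cls (gL # p)) = cls (gL # p)"
  "act [gR0] (cls (gK # gK # gK # p)) = cls (gK # gK # p)"
  "act [gR0] (cls (gK # gK # gL # p)) = cls (gK # gL # gK # p)"
  "act [gR0] (cls (gK # gL # p)) = cls (gK # gL # gL # p)"
  "act [gR0] (cls (gL # p)) = cls (gL # p)"
  "act mP (cls (gK # p)) = cls (gL # p)"
  "act mP (cls (gL # p)) = cls (gK # p)"
  "act mR (cls (gK # gK # p)) = cls (gK # p)"
  "act mR (cls (gK # gL # p)) = cls (gL # gK # p)"
  "act mR (cls (gL # p)) = cls (gL # gL # p)"
  "act mRi (cls (gK # p)) = cls (gK # gK # p)"
  "act mRi (cls (gL # gK # p)) = cls (gK # gL # p)"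
  "act mRi (cls (gL # gL # p)) = cls (gL # p)"
  "act [gL] (cls p) = cls (gL # p)"
  "act [gK] (cls p) = cls (gK # p)"
  by (simp_all add: act_cls acts)

private lemma K0_steps:
  "act mK0 (cls (gK # p)) = cls (gK # gK # p)"
  "act mK0 (cls (gL # p)) = cls (gL # p)"
  unfolding mK0_def by (simp_all only: act_append act_steps)

private lemma gdefer0_K: "act (gdefer0 g) (cls [gK]) = cls [gK, g]"
proof (cases g)
  case gK
  then show ?thesis by (simp only: gdefer0.simps K0_steps)
next
  case gL
  then show ?thesis unfolding gL gdefer0.simps by (simp only: act_append act_steps)
next
  case gU
  have *: "act ([gU] @ mK0 @ mR) (cls (gK # gK # p)) = cls (gK # p)"
    "act ([gU] @ mK0 @ mR) (cls (gK # gL # p)) = cls (gK # p)" for p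
    by (simp_all only: act_append act_steps K0_steps)
  have "cls (([gU] @ mK0 @ mR) @ [gK]) = cls [gK, gU]"
    by (rule ext) (use *[of "[]"] cong_in[OF gen_steps(1), of "[gK]" "[]"]
        cong_in[OF gen_steps(2), of "[gK]" "[]"] in \<open>simp_all add: act_cls\<close>)
  then show ?thesis unfolding gU gdefer0.simps act_cls .
next
  case gP0
  have *: "act (mRi @ [gP0] @ mR) (cls (gK # gK # gK # p)) = cls (gK # gK # gL # p)"
    "act (mRi @ [gP0] @ mR) (cls (gK # gK # gL # p)) = cls (gK # gK # gK # p)"
    "act (mRi @ [gP0] @ mR) (cls (gK # gL # p)) = cls (gK # gL # p)" for p
    by (simp_all only: act_append act_steps)
  have 1: "cls (((mRi @ [gP0] @ mR) @ [gK]) @ [gK]) = cls ([gK, gP0] @ [gK])"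
    by (rule ext) (use *[of "[]"] cong_in[OF gen_steps(3), of "[gK]" "[]"]
        cong_in[OF gen_steps(4), of "[gK]" "[]"] in \<open>simp_all add: act_cls\<close>)
  have "cls ((mRi @ [gP0] @ mR) @ [gK]) = cls [gK, gP0]"
    by (rule ext[OF 1]) (use *[of "[]"] cong_in[OF gen_steps(5), of "[gK]" "[]"]
        in \<open>simp add: act_cls\<close>)
  then show ?thesis unfolding gP0 gdefer0.simps act_cls .
next
  case gR0
  have *: "act (mRi @ [gR0] @ mR) (cls (gK # gK # gK # gK # p)) = cls (gK # gK # gK # p)"
    "act (mRi @ [gR0] @ mR) (cls (gK # gK # gK # gL # p)) = cls (gK # gK # gL # gK # p)"
    "act (mRi @ [gR0] @ mR) (cls (gK # gK # gL # p)) = cls (gK # gK # gL # gL # p)"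
    "act (mRi @ [gR0] @ mR) (cls (gK # gL # p)) = cls (gK # gL # p)" for p
    by (simp_all only: act_append act_steps)
  have 1: "cls ((((mRi @ [gR0] @ mR) @ [gK]) @ [gK]) @ [gK]) = cls (([gK, gR0] @ [gK]) @ [gK])"
    by (rule ext) (use *[of "[]"] cong_in[OF gen_steps(6), of "[gK]" "[]"]
        cong_in[OF gen_steps(7), of "[gK]" "[]"] in \<open>simp_all add: act_cls\<close>)
  have 2: "cls (((mRi @ [gR0] @ mR) @ [gK]) @ [gK]) = cls ([gK, gR0] @ [gK])"
    by (rule ext[OF 1]) (use *[of "[]"] cong_in[OF gen_steps(8), of "[gK]" "[]"]
        in \<open>simp add: act_cls\<close>)
  have "cls ((mRi @ [gR0] @ mR) @ [gK]) = cls [gK, gR0]"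
    by (rule ext[OF 2]) (use *[of "[]"] cong_in[OF gen_steps(9), of "[gK]" "[]"]
        in \<open>simp add: act_cls\<close>)
  then show ?thesis unfolding gR0 gdefer0.simps act_cls .
qed

private lemma gdefer0_L: "act (gdefer0 g) (cls [gL]) = cls [gL]"
  by (cases g) (simp_all only: gdefer0.simps act_append act_steps K0_steps)

lemma defer0_K: "defer0 x @ [gK] \<approx> [gK] @ x"
proof (induction x)
  case (Cons g x)
  have "defer0 (g # x) @ [gK] = gdefer0 g @ (defer0 x @ [gK])"
    by (simp add: defer0_def)
  also have "\<dots> \<approx> gdefer0 g @ ([gK] @ x)"
    by (intro cong_right Cons.IH)
  finally have 1: "defer0 (g # x) @ [gK] \<approx> (gdefer0 g @ [gK]) @ x" by simp
  have "gdefer0 g @ [gK] \<approx> [gK, g]"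
    using gdefer0_K[of g] by (simp only: act_cls cls_eq)
  from pcong.cong_trans[OF 1 cong_left[OF this]] show ?case by simp
qed (simp add: defer0_def mrefl)

lemma defer0_L: "defer0 x @ [gL] \<approx> [gL]"
proof (induction x)
  case (Cons g x)
  have "defer0 (g # x) @ [gL] = gdefer0 g @ (defer0 x @ [gL])"
    by (simp add: defer0_def)
  also have "\<dots> \<approx> gdefer0 g @ [gL]"
    by (intro cong_right Cons.IH)
  finally have 1: "defer0 (g # x) @ [gL] \<approx> gdefer0 g @ [gL]" .
  have "gdefer0 g @ [gL] \<approx> [gL]"
    using gdefer0_L[of g] by (simp only: act_cls cls_eq)
  from pcong.cong_trans[OF 1 this] show ?case .
qed (simp add: defer0_def mrefl)

lemma defer1_K: "defer1 x @ [gK] \<approx> [gK]"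
proof -
  have "cls (defer1 x @ [gK]) = act mP (act (defer0 x) (act mP (cls [gK])))"
    by (simp add: defer1_def act_cls)
  also have "act (defer0 x) (act mP (cls [gK])) = cls [gL]"
    using defer0_L[of x] unfolding act_steps by (simp only: act_cls cls_eq)
  finally show ?thesis by (simp only: act_steps cls_eq)
qed

lemma defer1_L: "defer1 x @ [gL] \<approx> [gL] @ x"
proof -
  have "cls (defer1 x @ [gL]) = act mP (act (defer0 x) (act mP (cls [gL])))"
    by (simp add: defer1_def act_cls)
  also have "act (defer0 x) (act mP (cls [gL])) = cls ([gK] @ x)"
    using defer0_K[of x] unfolding act_steps by (simp only: act_cls cls_eq)
  finally show ?thesis by (simp add: act_steps cls_eq)
qed

lemma defer0_P: "defer0 mP \<approx> [gP0]"
proof (rule projections_determine)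
  have "cls ([gK] @ mP) = cls ([gP0] @ [gK])"
    by (rule ext) (use cong_in[OF PR_steps(1), of "[gK]" "[]"] cong_in[OF PR_steps(2), of "[gK]" "[]"]
        gen_steps(3,4)[of "[]"] in simp_all)
  then show "defer0 mP @ [gK] \<approx> [gP0] @ [gK]"
    using defer0_K[of mP] by (metis cls_eq)
  show "defer0 mP @ [gL] \<approx> [gP0] @ [gL]"
    using defer0_L[of mP] gen_steps(5)[of "[]"] by (metis cls_eq append_Cons append_Nil)
qed

lemma defer0_R: "defer0 mR \<approx> [gR0]"
proof (rule projections_determine)
  have 1: "cls (([gK] @ mR) @ [gK]) = cls (([gR0] @ [gK]) @ [gK])"
    by (rule ext) (use cong_in[OF PR_steps(3), of "[gK]" "[]"] cong_in[OF PR_steps(4), of "[gK]" "[]"]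
        gen_steps(6,7)[of "[]"] in simp_all)
  have "cls ([gK] @ mR) = cls ([gR0] @ [gK])"
    by (rule ext[OF 1]) (use cong_in[OF PR_steps(5), of "[gK]" "[]"] gen_steps(8)[of "[]"] in simp)
  then show "defer0 mR @ [gK] \<approx> [gR0] @ [gK]"
    using defer0_K[of mR] by (metis cls_eq)
  show "defer0 mR @ [gL] \<approx> [gR0] @ [gL]"
    using defer0_L[of mR] gen_steps(9)[of "[]"] by (metis cls_eq append_Cons append_Nil)
qed

end

end

theory Submission
  imports Defs
begin

text \<open>A relation algebra satisfies the axioms of J-algebras, so one may argue in a J-algebra.  Put
  \<open>fork x y = x;a\<^sup>\<smile> \<cdot> y;b\<^sup>\<smile>\<close>.  A functional element \<open>x\<close> equals \<open>fork (x;a) (x;b)\<close>, hence is determined by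
  \<open>x;a\<close> and \<open>x;b\<close>, and all named elements are iterated forks of products of \<open>a\<close> and \<open>b\<close>.  Their
  products with sufficiently long words in \<open>a\<close> and \<open>b\<close> are therefore again such words, and each
  relation is verified by computing both sides on the leaves of a finite binary tree.  The laws for
  arbitrary functional \<open>x\<close> reduce to \<open>fork x y;u\<^sub>0 = fork (x;u) y\<close> and \<open>fork x y;u\<^sub>1 = fork x (y;u)\<close>.
  For the two generating sets in (vii), the elements whose deferment lies in the submonoid generated
  by \<open>P, R, K, U\<close> are closed under products and forks.\<close>

section \<open>Relation algebras are J-algebras\<close>

text \<open>For binary relations on a set, with \<open>1\<close> the full relation, the hypotheses
  make \<open>a\<close> and \<open>b\<close> the projections of a pairing: every point is one pair,
  and every pair is a point. A functional element is then a partial map on nested pairs, and the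
  named elements only copy, delete and rearrange components. Two obstacles shape the proof. A fork
  of partial maps lives on the common domain, so \<open>fork x y;a\<close> is \<open>x\<close> cut
  down to the domain of \<open>y\<close>. Finite calculations are therefore confined to total
  elements, which by \<open>a;1 = b;1 = 1\<close> include every named one; for the laws about
  arbitrary functional elements the cuts have to be shown to cancel. Secondly, the presentation of
  the monoid imposes each relation together with all its deferments, where deferment is an operation
  on words. Evaluation of words must therefore be shown to commute with deferment, and this requires
  equations that express the deferments of the generators by products.\<close>

locale meet_semilattice =
  fixes \<AA> :: "('a, 'm) j_alg_scheme" (structure)
  assumes meet_closed: "x \<in> carrier \<AA> \<Longrightarrow> y \<in> carrier \<AA> \<Longrightarrow> x \<cdot> y \<in> carrier \<AA>"
    and meet_assoc: "\<lbrakk>x \<in> carrier \<AA>; y \<in> carrier \<AA>; z \<in> carrier \<AA>\<rbrakk> \<Longrightarrow> x \<cdot> (y \<cdot> z) = (x \<cdot> y) \<cdot> z"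
    and meet_comm: "\<lbrakk>x \<in> carrier \<AA>; y \<in> carrier \<AA>\<rbrakk> \<Longrightarrow> x \<cdot> y = y \<cdot> x"
    and meet_idem: "x \<in> carrier \<AA> \<Longrightarrow> x \<cdot> x = x"
begin

lemma le_refl: "x \<in> carrier \<AA> \<Longrightarrow> x \<preceq> x"
  by (simp add: rle_def meet_idem)

lemma le_trans [trans]:
  "\<lbrakk>x \<preceq> y; y \<preceq> z; x \<in> carrier \<AA>; y \<in> carrier \<AA>; z \<in> carrier \<AA>\<rbrakk> \<Longrightarrow> x \<preceq> z"
  unfolding rle_def by (metis meet_assoc)

lemma le_antisym: "\<lbrakk>x \<preceq> y; y \<preceq> x; x \<in> carrier \<AA>; y \<in> carrier \<AA>\<rbrakk> \<Longrightarrow> x = y"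
  unfolding rle_def by (metis meet_comm)

lemma meet_le1: "\<lbrakk>x \<in> carrier \<AA>; y \<in> carrier \<AA>\<rbrakk> \<Longrightarrow> x \<cdot> y \<preceq> x"
  unfolding rle_def by (metis meet_assoc meet_comm meet_idem)

lemma meet_le2: "\<lbrakk>x \<in> carrier \<AA>; y \<in> carrier \<AA>\<rbrakk> \<Longrightarrow> x \<cdot> y \<preceq> y"
  unfolding rle_def by (metis meet_assoc meet_idem)

lemma le_meetI:
  "\<lbrakk>z \<preceq> x; z \<preceq> y; x \<in> carrier \<AA>; y \<in> carrier \<AA>; z \<in> carrier \<AA>\<rbrakk> \<Longrightarrow> z \<preceq> x \<cdot> y"
  unfolding rle_def by (simp add: meet_assoc)

lemma meet_mono:
  assumes "x \<preceq> x'" "y \<preceq> y'"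
    and [simp]: "x \<in> carrier \<AA>" "y \<in> carrier \<AA>" "x' \<in> carrier \<AA>" "y' \<in> carrier \<AA>"
  shows "x \<cdot> y \<preceq> x' \<cdot> y'"
  by (rule le_meetI)
    (auto intro: le_trans[OF meet_le1 assms(1)] le_trans[OF meet_le2 assms(2)] simp: meet_closed)

end

context relation_algebra
begin

lemmas closed [simp, intro] =
  bsum_closed bprod_closed bcompl_closed bzero_closed bone_closed rprod_closed rconv_closed rid_closed

section \<open>Boolean algebra from Huntington's equation\<close>

lemma bsum_left_comm:
  "\<lbrakk>x \<in> carrier \<AA>; y \<in> carrier \<AA>; z \<in> carrier \<AA>\<rbrakk> \<Longrightarrow> x \<^bold>+ (y \<^bold>+ z) = y \<^bold>+ (x \<^bold>+ z)"
  by (metis bsum_assoc bsum_comm)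

lemmas bsum_ac = bsum_assoc[symmetric] bsum_comm bsum_left_comm

text \<open>Expanding \<open>x\<close>, \<open>y\<close> and their complements by Huntington's
  equation turns both sides into the same four summands, one for each choice of signs.\<close>

lemma bsum_bcompl_eq:
  assumes [simp]: "x \<in> carrier \<AA>" "y \<in> carrier \<AA>"
  shows "x \<^bold>+ \<sim>x = y \<^bold>+ \<sim>y"
proof -
  have "x \<^bold>+ \<sim>x = (\<sim>(\<sim>x \<^bold>+ \<sim>(\<sim>y)) \<^bold>+ \<sim>(\<sim>x \<^bold>+ \<sim>y)) \<^bold>+ (\<sim>(\<sim>(\<sim>x) \<^bold>+ \<sim>(\<sim>y)) \<^bold>+ \<sim>(\<sim>(\<sim>x) \<^bold>+ \<sim>y))"
    using huntington[of x "\<sim>y"] huntington[of "\<sim>x" "\<sim>y"] by simp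
  also have "\<dots> = (\<sim>(\<sim>y \<^bold>+ \<sim>(\<sim>x)) \<^bold>+ \<sim>(\<sim>y \<^bold>+ \<sim>x)) \<^bold>+ (\<sim>(\<sim>(\<sim>y) \<^bold>+ \<sim>(\<sim>x)) \<^bold>+ \<sim>(\<sim>(\<sim>y) \<^bold>+ \<sim>x))"
    by (simp add: bsum_ac)
  also have "\<dots> = y \<^bold>+ \<sim>y"
    using huntington[of y "\<sim>x"] huntington[of "\<sim>y" "\<sim>x"] by simp
  finally show ?thesis .
qed

lemma bsum_bcompl: "x \<in> carrier \<AA> \<Longrightarrow> x \<^bold>+ \<sim>x = \<^bold>1"
  using bsum_bcompl_eq[of x "\<^bold>1'"] by (simp add: bone_eq)

text \<open>Huntington's equation expands the double complement of \<open>x\<close>, split by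
  \<open>\<sim>x\<close>, and \<open>x\<close>, split by \<open>\<sim>(\<sim>x)\<close>, into equal
  summands: one is common by commutativity, the other is in both cases the complement of the
  unit.\<close>

lemma bcompl_bcompl [simp]:
  assumes [simp]: "x \<in> carrier \<AA>"
  shows "\<sim>(\<sim>x) = x"
proof -
  have "\<sim>(\<sim>x) = \<sim>(\<sim>(\<sim>(\<sim>x)) \<^bold>+ \<sim>(\<sim>x)) \<^bold>+ \<sim>(\<sim>(\<sim>(\<sim>x)) \<^bold>+ \<sim>x)"
    using huntington[of "\<sim>(\<sim>x)" "\<sim>x"] by simp
  also have "\<dots> = \<sim>(\<sim>x \<^bold>+ \<sim>(\<sim>(\<sim>x))) \<^bold>+ \<sim>(\<sim>x \<^bold>+ \<sim>(\<sim>x))"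
    using bsum_bcompl[of "\<sim>x"] bsum_bcompl[of "\<sim>(\<sim>x)"] by (simp add: bsum_ac)
  also have "\<dots> = x"
    using huntington[of x "\<sim>(\<sim>x)"] by simp
  finally show ?thesis .
qed

lemma bcompl_bone: "\<sim>\<^bold>1 = \<^bold>0"
  by (simp add: bzero_eq)

lemma bcompl_bzero: "\<sim>\<^bold>0 = \<^bold>1"
  by (simp add: bzero_eq)

text \<open>This is the seed of neutrality of \<open>0\<close> and of idempotence. Huntington's
  equation at \<open>0\<close> and \<open>1\<close> shows that \<open>0\<close> absorbs the
  complement of \<open>1 + 1\<close>; hence \<open>1\<close> absorbs it, and regrouping joins
  \<open>1 + 1\<close> to its own complement.\<close>

lemma bone_bsum_bone: "\<^bold>1 \<^bold>+ \<^bold>1 = \<^bold>1"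
proof -
  have 1: "\<^bold>1 \<^bold>+ \<^bold>0 = \<^bold>1"
    using bsum_bcompl[of "\<^bold>1"] by (simp add: bcompl_bone)
  have 2: "\<^bold>0 \<^bold>+ \<sim>(\<^bold>1 \<^bold>+ \<^bold>1) = \<^bold>0"
    using huntington[of "\<^bold>0" "\<^bold>1"] by (simp add: bcompl_bone bcompl_bzero 1)
  have 3: "\<^bold>1 \<^bold>+ \<sim>(\<^bold>1 \<^bold>+ \<^bold>1) = \<^bold>1"
    using 1 2 bsum_assoc[of "\<^bold>1" "\<^bold>0" "\<sim>(\<^bold>1 \<^bold>+ \<^bold>1)"] by simp
  have "\<^bold>1 \<^bold>+ \<^bold>1 = \<^bold>1 \<^bold>+ (\<^bold>1 \<^bold>+ \<sim>(\<^bold>1 \<^bold>+ \<^bold>1))"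
    by (simp add: 3)
  also have "\<dots> = (\<^bold>1 \<^bold>+ \<^bold>1) \<^bold>+ \<sim>(\<^bold>1 \<^bold>+ \<^bold>1)"
    by (simp add: bsum_assoc)
  also have "\<dots> = \<^bold>1"
    by (rule bsum_bcompl) simp
  finally show ?thesis .
qed

text \<open>Huntington's equation with equal arguments writes \<open>x\<close> as something plus
  \<open>0\<close>, and \<open>0 + 0 = 0\<close> swallows a further \<open>0\<close>.\<close>

lemma bsum_bzero [simp]:
  assumes [simp]: "x \<in> carrier \<AA>"
  shows "x \<^bold>+ \<^bold>0 = x"
proof -
  have 0: "\<^bold>0 \<^bold>+ \<^bold>0 = \<^bold>0"
    using huntington[of "\<^bold>0" "\<^bold>1"] bsum_bcompl[of "\<^bold>1"]
    by (simp add: bcompl_bone bcompl_bzero bone_bsum_bone)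
  have "x = \<sim>(\<sim>x \<^bold>+ \<sim>x) \<^bold>+ \<^bold>0"
    using huntington[of x x] bsum_bcompl[of x] by (simp add: bsum_comm bcompl_bone)
  moreover have "(\<sim>(\<sim>x \<^bold>+ \<sim>x) \<^bold>+ \<^bold>0) \<^bold>+ \<^bold>0 = \<sim>(\<sim>x \<^bold>+ \<sim>x) \<^bold>+ \<^bold>0"
    by (simp add: bsum_assoc[symmetric] 0)
  ultimately show ?thesis
    by metis
qed

lemma bsum_idem [simp]:
  assumes [simp]: "x \<in> carrier \<AA>"
  shows "x \<^bold>+ x = x"
proof -
  have "\<sim>x = \<sim>(x \<^bold>+ x)"
    using huntington[of "\<sim>x" "\<sim>x"] bsum_bcompl[of x] by (simp add: bcompl_bone)
  then show ?thesis
    by (metis assms bcompl_bcompl bsum_closed)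
qed

lemma bsum_bone: "x \<in> carrier \<AA> \<Longrightarrow> x \<^bold>+ \<^bold>1 = \<^bold>1"
  using bsum_assoc[of x x "\<sim>x"] by (simp add: bsum_bcompl)

lemma bcompl_bsum: "\<lbrakk>x \<in> carrier \<AA>; y \<in> carrier \<AA>\<rbrakk> \<Longrightarrow> \<sim>(x \<^bold>+ y) = \<sim>x \<cdot> \<sim>y"
  by (simp add: bprod_eq)

lemma bsplit: "\<lbrakk>x \<in> carrier \<AA>; y \<in> carrier \<AA>\<rbrakk> \<Longrightarrow> x \<cdot> y \<^bold>+ x \<cdot> \<sim>y = x"
  by (simp add: bprod_eq huntington)

lemma bprod_commute: "\<lbrakk>x \<in> carrier \<AA>; y \<in> carrier \<AA>\<rbrakk> \<Longrightarrow> x \<cdot> y = y \<cdot> x"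
  by (simp add: bprod_eq bsum_comm)

lemma bprod_bsum_absorb:
  "\<lbrakk>x \<in> carrier \<AA>; y \<in> carrier \<AA>\<rbrakk> \<Longrightarrow> x \<cdot> y \<^bold>+ x = x"
  using bsum_assoc[of "x \<cdot> y" "x \<cdot> y" "x \<cdot> \<sim>y"] by (simp add: bsplit)

text \<open>The direction from sums to meets is the other one, dualized: absorption is applied to
  the complements.\<close>

lemma le_iff_bsum:
  assumes [simp]: "x \<in> carrier \<AA>" "y \<in> carrier \<AA>"
  shows "x \<cdot> y = x \<longleftrightarrow> x \<^bold>+ y = y"
proof
  show "x \<cdot> y = x \<Longrightarrow> x \<^bold>+ y = y"
    by (metis assms bprod_bsum_absorb bprod_commute)
  assume "x \<^bold>+ y = y"
  then have "\<sim>y \<cdot> \<sim>x = \<sim>y"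
    by (metis assms bcompl_bsum bcompl_closed bprod_commute)
  then have "\<sim>y \<^bold>+ \<sim>x = \<sim>x"
    by (metis assms bcompl_closed bprod_bsum_absorb bprod_commute)
  then show "x \<cdot> y = x"
    by (simp add: bprod_eq bsum_comm)
qed

section \<open>Tarski's axiom, converse and the Dedekind laws\<close>

lemma tarski': "\<lbrakk>x \<in> carrier \<AA>; y \<in> carrier \<AA>\<rbrakk> \<Longrightarrow> x\<^sup>\<smile> \<Zcomp> \<sim>(x \<Zcomp> y) \<cdot> \<sim>y = x\<^sup>\<smile> \<Zcomp> \<sim>(x \<Zcomp> y)"
  by (simp add: le_iff_bsum tarski)

lemma rprod_bsum_right:
  assumes [simp]: "x \<in> carrier \<AA>" "y \<in> carrier \<AA>" "z \<in> carrier \<AA>"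
  shows "x \<Zcomp> (y \<^bold>+ z) = x \<Zcomp> y \<^bold>+ x \<Zcomp> z"
proof -
  have "(x \<Zcomp> (y \<^bold>+ z))\<^sup>\<smile> = (x \<Zcomp> y \<^bold>+ x \<Zcomp> z)\<^sup>\<smile>"
    by (simp add: rconv_rprod rconv_bsum rprod_bsum)
  then show ?thesis
    by (metis assms bsum_closed rconv_rconv rprod_closed)
qed

lemma rconv_le:
  assumes "x \<preceq> y" and [simp]: "x \<in> carrier \<AA>" "y \<in> carrier \<AA>"
  shows "x\<^sup>\<smile> \<preceq> y\<^sup>\<smile>"
  using assms(1) rconv_bsum[of x y] by (simp add: rle_def le_iff_bsum)

lemma rprod_le_left:
  assumes "x \<preceq> y" and [simp]: "x \<in> carrier \<AA>" "y \<in> carrier \<AA>" "z \<in> carrier \<AA>"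
  shows "x \<Zcomp> z \<preceq> y \<Zcomp> z"
  using assms(1) rprod_bsum[of x y z] by (simp add: rle_def le_iff_bsum)

lemma rprod_le_right:
  assumes "x \<preceq> y" and [simp]: "x \<in> carrier \<AA>" "y \<in> carrier \<AA>" "z \<in> carrier \<AA>"
  shows "z \<Zcomp> x \<preceq> z \<Zcomp> y"
  using assms(1) rprod_bsum_right[of z x y] by (simp add: rle_def le_iff_bsum)

lemma bprod_bcompl: "x \<in> carrier \<AA> \<Longrightarrow> x \<cdot> \<sim>x = \<^bold>0"
  using bsum_bcompl[of "\<sim>x"] by (simp add: bprod_eq bcompl_bone)

lemma bzero_meet: "x \<in> carrier \<AA> \<Longrightarrow> \<^bold>0 \<cdot> x = \<^bold>0"
  by (simp add: bprod_eq bcompl_bzero bsum_comm[of "\<^bold>1"] bsum_bone bcompl_bone)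

lemma meet_bone: "x \<in> carrier \<AA> \<Longrightarrow> x \<cdot> \<^bold>1 = x"
  by (simp add: bprod_eq bcompl_bone)

sublocale meet_semilattice
proof
  fix x y z assume [simp]: "x \<in> carrier \<AA>" "y \<in> carrier \<AA>" "z \<in> carrier \<AA>"
  show "x \<cdot> (y \<cdot> z) = (x \<cdot> y) \<cdot> z"
    by (simp add: bprod_eq bsum_assoc)
qed (simp_all add: bprod_commute, simp add: bprod_eq)

lemma le_bcomplI:
  assumes "x \<cdot> y = \<^bold>0" and [simp]: "x \<in> carrier \<AA>" "y \<in> carrier \<AA>"
  shows "x \<preceq> \<sim>y"
  using bsplit[of x y] assms(1) by (simp add: rle_def bsum_comm[of "\<^bold>0"])

lemma rconv_meet:
  assumes [simp]: "x \<in> carrier \<AA>" "y \<in> carrier \<AA>"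
  shows "(x \<cdot> y)\<^sup>\<smile> = x\<^sup>\<smile> \<cdot> y\<^sup>\<smile>"
proof (rule le_antisym)
  show "(x \<cdot> y)\<^sup>\<smile> \<preceq> x\<^sup>\<smile> \<cdot> y\<^sup>\<smile>"
    by (intro le_meetI rconv_le meet_le1 meet_le2) auto
  have "(x\<^sup>\<smile> \<cdot> y\<^sup>\<smile>)\<^sup>\<smile> \<preceq> x \<cdot> y"
  proof (rule le_meetI)
    show "(x\<^sup>\<smile> \<cdot> y\<^sup>\<smile>)\<^sup>\<smile> \<preceq> x"
      using rconv_le[OF meet_le1, of "x\<^sup>\<smile>" "y\<^sup>\<smile>"] by (simp add: rconv_rconv)
    show "(x\<^sup>\<smile> \<cdot> y\<^sup>\<smile>)\<^sup>\<smile> \<preceq> y"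
      using rconv_le[OF meet_le2, of "x\<^sup>\<smile>" "y\<^sup>\<smile>"] by (simp add: rconv_rconv)
  qed auto
  then show "x\<^sup>\<smile> \<cdot> y\<^sup>\<smile> \<preceq> (x \<cdot> y)\<^sup>\<smile>"
    using rconv_le[of "(x\<^sup>\<smile> \<cdot> y\<^sup>\<smile>)\<^sup>\<smile>" "x \<cdot> y"] by (simp add: rconv_rconv)
qed auto

lemma le_bone: "x \<in> carrier \<AA> \<Longrightarrow> x \<preceq> \<^bold>1"
  by (simp add: rle_def meet_bone)

lemma bzero_le: "x \<in> carrier \<AA> \<Longrightarrow> \<^bold>0 \<preceq> x"
  by (simp add: rle_def bzero_meet)

lemma rconv_bone: "\<^bold>1\<^sup>\<smile> = \<^bold>1"
  using rconv_le[OF le_bone, of "\<^bold>1\<^sup>\<smile>"]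
  by (auto intro!: le_antisym le_bone simp: rconv_rconv)

lemma rconv_bzero: "\<^bold>0\<^sup>\<smile> = \<^bold>0"
  using rconv_le[OF bzero_le, of "\<^bold>0\<^sup>\<smile>"]
  by (auto intro!: le_antisym bzero_le simp: rconv_rconv)

lemma rconv_bcompl:
  assumes [simp]: "x \<in> carrier \<AA>"
  shows "(\<sim>x)\<^sup>\<smile> = \<sim>(x\<^sup>\<smile>)"
proof (rule le_antisym)
  have "(\<sim>x)\<^sup>\<smile> \<cdot> x\<^sup>\<smile> = \<^bold>0"
    using rconv_meet[of "\<sim>x" x] by (simp add: bprod_commute[of "\<sim>x" x] bprod_bcompl rconv_bzero)
  then show "(\<sim>x)\<^sup>\<smile> \<preceq> \<sim>(x\<^sup>\<smile>)"
    by (simp add: le_bcomplI)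
  have "x\<^sup>\<smile> \<^bold>+ (\<sim>x)\<^sup>\<smile> = \<^bold>1"
    using rconv_bsum[of x "\<sim>x"] by (simp add: bsum_bcompl rconv_bone)
  then have "\<sim>(x\<^sup>\<smile>) \<cdot> \<sim>((\<sim>x)\<^sup>\<smile>) = \<^bold>0"
    by (simp add: bprod_eq bcompl_bone)
  then show "\<sim>(x\<^sup>\<smile>) \<preceq> (\<sim>x)\<^sup>\<smile>"
    using le_bcomplI[of "\<sim>(x\<^sup>\<smile>)" "\<sim>((\<sim>x)\<^sup>\<smile>)"] by simp
qed auto

text \<open>Tarski's axiom seen through converse: whatever lies outside
  \<open>z;y\<^sup>\<smile>\<close> remains outside \<open>z\<close> after composition with
  \<open>y\<close>.\<close>

lemma tarski_right:
  assumes [simp]: "y \<in> carrier \<AA>" "z \<in> carrier \<AA>"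
  shows "\<sim>(z \<Zcomp> y\<^sup>\<smile>) \<Zcomp> y \<preceq> \<sim>z"
proof -
  have "y\<^sup>\<smile> \<Zcomp> \<sim>(y \<Zcomp> z\<^sup>\<smile>) \<preceq> \<sim>(z\<^sup>\<smile>)"
    by (simp add: rle_def tarski')
  from rconv_le[OF this] show ?thesis
    by (simp add: rconv_rprod rconv_bcompl rconv_rconv)
qed

text \<open>Split \<open>x\<close> by \<open>z;y\<^sup>\<smile>\<close>. By
  \<open>tarski_right\<close> the outer part contributes to \<open>x;y\<close> only outside
  \<open>z\<close>, so inside \<open>z\<close> the inner part accounts for everything.\<close>

lemma dedekind_left:
  assumes [simp]: "x \<in> carrier \<AA>" "y \<in> carrier \<AA>" "z \<in> carrier \<AA>"
  shows "x \<Zcomp> y \<cdot> z \<preceq> (x \<cdot> z \<Zcomp> y\<^sup>\<smile>) \<Zcomp> y"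
proof -
  let ?w = "z \<Zcomp> y\<^sup>\<smile>"
  let ?p = "(x \<cdot> ?w) \<Zcomp> y"
  have "x \<Zcomp> y = ?p \<^bold>+ (x \<cdot> \<sim>?w) \<Zcomp> y"
    by (metis assms bsplit rprod_bsum bprod_closed bcompl_closed rprod_closed rconv_closed)
  moreover have "(x \<cdot> \<sim>?w) \<Zcomp> y \<preceq> \<sim>z"
    by (rule le_trans[OF rprod_le_left[OF meet_le2] tarski_right]) auto
  then have "(x \<cdot> \<sim>?w) \<Zcomp> y \<^bold>+ \<sim>z = \<sim>z"
    by (simp add: rle_def le_iff_bsum)
  moreover have "(?p \<^bold>+ (x \<cdot> \<sim>?w) \<Zcomp> y) \<^bold>+ (?p \<^bold>+ \<sim>z) = (?p \<^bold>+ ?p) \<^bold>+ ((x \<cdot> \<sim>?w) \<Zcomp> y \<^bold>+ \<sim>z)"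
    by (simp add: bsum_ac del: bsum_idem)
  ultimately have "x \<Zcomp> y \<^bold>+ (?p \<^bold>+ \<sim>z) = ?p \<^bold>+ \<sim>z"
    by simp
  then have "x \<Zcomp> y \<preceq> ?p \<^bold>+ \<sim>z"
    by (simp add: rle_def le_iff_bsum)
  then have 1: "x \<Zcomp> y \<cdot> z \<preceq> (?p \<^bold>+ \<sim>z) \<cdot> z"
    by (rule meet_mono) (auto intro: le_refl)
  have "((?p \<^bold>+ \<sim>z) \<cdot> z) \<cdot> \<sim>?p = (z \<cdot> \<sim>?p) \<cdot> \<sim>(z \<cdot> \<sim>?p)"
    by (simp add: bprod_eq bsum_ac)
  also have "\<dots> = \<^bold>0"
    by (simp add: bprod_bcompl)
  finally have "(?p \<^bold>+ \<sim>z) \<cdot> z \<preceq> ?p"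
    using le_bcomplI[of "(?p \<^bold>+ \<sim>z) \<cdot> z" "\<sim>?p"] by simp
  with 1 show ?thesis
    by (rule le_trans) auto
qed

lemma dedekind_right:
  assumes [simp]: "x \<in> carrier \<AA>" "y \<in> carrier \<AA>" "z \<in> carrier \<AA>"
  shows "x \<Zcomp> y \<cdot> z \<preceq> x \<Zcomp> (y \<cdot> x\<^sup>\<smile> \<Zcomp> z)"
  using rconv_le[OF dedekind_left[of "y\<^sup>\<smile>" "x\<^sup>\<smile>" "z\<^sup>\<smile>"]]
  by (simp add: rconv_rprod rconv_meet rconv_rconv)

text \<open>The rotation axiom is the main point: its nontrivial half is Dedekind's law used twice,
  once to narrow each factor.\<close>

theorem is_j_algebra: "j_algebra \<AA>"
proof
  fix x y z assume c [simp]: "x \<in> carrier \<AA>" "y \<in> carrier \<AA>" "z \<in> carrier \<AA>"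
  let ?u = "z \<Zcomp> y\<^sup>\<smile> \<cdot> x"
  let ?v = "y \<cdot> x\<^sup>\<smile> \<Zcomp> z"
  show "(x \<cdot> y) \<Zcomp> z = (x \<cdot> y) \<Zcomp> z \<cdot> y \<Zcomp> z"
    using rprod_le_left[OF meet_le2, of x y z] by (simp add: rle_def)
  show "x \<Zcomp> y \<cdot> z = ?u \<Zcomp> ?v \<cdot> z"
  proof (rule le_antisym)
    have "x \<Zcomp> y \<cdot> z \<preceq> ?u \<Zcomp> y \<cdot> z"
      using dedekind_left[of x y z]
      by (intro le_meetI meet_le2) (auto simp: bprod_commute)
    \<comment> \<open>The second factor is narrowed relative to \<open>?u\<close>; as
      \<open>?u\<close> lies below \<open>x\<close>, enlarging it to \<open>x\<close> in that place
      gives \<open>?v\<close>.\<close>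
    from this dedekind_right[of ?u y z] have "x \<Zcomp> y \<cdot> z \<preceq> ?u \<Zcomp> (y \<cdot> ?u\<^sup>\<smile> \<Zcomp> z)"
      by (rule le_trans) auto
    moreover have "?u \<Zcomp> (y \<cdot> ?u\<^sup>\<smile> \<Zcomp> z) \<preceq> ?u \<Zcomp> ?v"
      by (intro rprod_le_right meet_mono rprod_le_left rconv_le meet_le2 le_refl) auto
    ultimately have "x \<Zcomp> y \<cdot> z \<preceq> ?u \<Zcomp> ?v"
      by (rule le_trans) auto
    then show "x \<Zcomp> y \<cdot> z \<preceq> ?u \<Zcomp> ?v \<cdot> z"
      by (intro le_meetI meet_le2) auto
    have "?u \<Zcomp> ?v \<preceq> x \<Zcomp> ?v"
      by (intro rprod_le_left meet_le2) auto
    moreover have "x \<Zcomp> ?v \<preceq> x \<Zcomp> y"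
      by (intro rprod_le_right meet_le1) auto
    ultimately have "?u \<Zcomp> ?v \<preceq> x \<Zcomp> y"
      by (rule le_trans) auto
    then show "?u \<Zcomp> ?v \<cdot> z \<preceq> x \<Zcomp> y \<cdot> z"
      by (rule meet_mono) (auto intro: le_refl)
  qed auto
next
  fix x assume c [simp]: "x \<in> carrier \<AA>"
  \<comment> \<open>Tarski's axiom at \<open>1\<close> and \<open>1\<close> bounds this by the
    complement of \<open>1\<close>. Since \<open>0\<close> lies below the second factor,
    \<open>1;0\<close> is bounded as well.\<close>
  have "\<^bold>1 \<Zcomp> \<sim>(\<^bold>1 \<Zcomp> \<^bold>1) \<preceq> \<^bold>0"
    using tarski'[of "\<^bold>1" "\<^bold>1"] by (simp add: rle_def rconv_bone bcompl_bone)
  with rprod_le_right[OF bzero_le] have "\<^bold>1 \<Zcomp> \<^bold>0 \<preceq> \<^bold>0"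
    by (rule le_trans) auto
  with rprod_le_left[OF le_bone] have "x \<Zcomp> \<^bold>0 \<preceq> \<^bold>0"
    by (rule le_trans) auto
  then show "x \<Zcomp> \<^bold>0 = \<^bold>0"
    by (rule le_antisym) (auto intro: bzero_le)
qed (rule bprod_closed bzero_closed bone_closed rprod_closed rconv_closed rid_closed meet_assoc
    bprod_commute meet_idem rprod_assoc rprod_rid rconv_rconv rconv_rprod rconv_meet bzero_meet
    meet_bone; assumption)+

end

section \<open>Functional elements of J-algebras\<close>

context j_algebra
begin

lemmas closed [simp, intro] =
  bprod_closed bzero_closed bone_closed rprod_closed rconv_closed rid_closed

sublocale meet_semilattice
  by unfold_locales (rule bprod_closed bprod_assoc bprod_comm bprod_idem; assumption)+

lemma bprod_left_comm:
  "\<lbrakk>x \<in> carrier \<AA>; y \<in> carrier \<AA>; z \<in> carrier \<AA>\<rbrakk> \<Longrightarrow> x \<cdot> (y \<cdot> z) = y \<cdot> (x \<cdot> z)"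
  by (metis bprod_assoc bprod_comm)

lemmas bprod_ac = bprod_assoc[symmetric] bprod_comm bprod_left_comm

lemmas rprod_right_assoc = rprod_assoc[symmetric]

lemma le_bone: "x \<in> carrier \<AA> \<Longrightarrow> x \<preceq> \<^bold>1"
  by (simp add: rle_def bprod_bone)

text \<open>\<open>1'\<close> is postulated as a right identity; once it is its own converse,
  converse yields the left identity law.\<close>

lemma rconv_rid: "\<^bold>1'\<^sup>\<smile> = \<^bold>1'"
  using rconv_rprod[of "\<^bold>1'\<^sup>\<smile>" "\<^bold>1'"] by (simp add: rconv_rconv rprod_rid)

lemma rid_rprod: "x \<in> carrier \<AA> \<Longrightarrow> \<^bold>1' \<Zcomp> x = x"
  using rconv_rprod[of "x\<^sup>\<smile>" "\<^bold>1'"] by (simp add: rconv_rconv rprod_rid rconv_rid)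

lemma rconv_le:
  assumes "x \<preceq> y" and [simp]: "x \<in> carrier \<AA>" "y \<in> carrier \<AA>"
  shows "x\<^sup>\<smile> \<preceq> y\<^sup>\<smile>"
  using assms(1) rconv_bprod[of x y] by (simp add: rle_def)

lemma rprod_le_left:
  assumes "x \<preceq> y" and [simp]: "x \<in> carrier \<AA>" "y \<in> carrier \<AA>" "z \<in> carrier \<AA>"
  shows "x \<Zcomp> z \<preceq> y \<Zcomp> z"
  using assms(1) rprod_mono[of x y z] by (simp add: rle_def)

lemma rprod_le_right:
  assumes "x \<preceq> y" and [simp]: "x \<in> carrier \<AA>" "y \<in> carrier \<AA>" "z \<in> carrier \<AA>"
  shows "z \<Zcomp> x \<preceq> z \<Zcomp> y"
  using rconv_le[OF rprod_le_left[OF rconv_le[OF assms(1)]], of "z\<^sup>\<smile>"]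
  by (simp add: rconv_rprod rconv_rconv)

lemma rconv_bone: "\<^bold>1\<^sup>\<smile> = \<^bold>1"
  using rconv_le[OF le_bone, of "\<^bold>1\<^sup>\<smile>"]
  by (auto intro!: le_antisym le_bone simp: rconv_rconv)

text \<open>In a J-algebra this is the rotation axiom with the narrowing of the second factor
  forgotten.\<close>

lemma dedekind_left:
  assumes [simp]: "x \<in> carrier \<AA>" "y \<in> carrier \<AA>" "z \<in> carrier \<AA>"
  shows "x \<Zcomp> y \<cdot> z \<preceq> (x \<cdot> z \<Zcomp> y\<^sup>\<smile>) \<Zcomp> y"
proof -
  have "x \<Zcomp> y \<cdot> z \<preceq> (z \<Zcomp> y\<^sup>\<smile> \<cdot> x) \<Zcomp> (y \<cdot> x\<^sup>\<smile> \<Zcomp> z)"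
    by (subst rotation) (auto intro: meet_le1)
  moreover have "(z \<Zcomp> y\<^sup>\<smile> \<cdot> x) \<Zcomp> (y \<cdot> x\<^sup>\<smile> \<Zcomp> z) \<preceq> (z \<Zcomp> y\<^sup>\<smile> \<cdot> x) \<Zcomp> y"
    by (intro rprod_le_right meet_le1) auto
  ultimately have "x \<Zcomp> y \<cdot> z \<preceq> (z \<Zcomp> y\<^sup>\<smile> \<cdot> x) \<Zcomp> y"
    by (rule le_trans) auto
  then show ?thesis
    by (simp add: bprod_comm[of x])
qed

lemma dedekind_right:
  assumes [simp]: "x \<in> carrier \<AA>" "y \<in> carrier \<AA>" "z \<in> carrier \<AA>"
  shows "x \<Zcomp> y \<cdot> z \<preceq> x \<Zcomp> (y \<cdot> x\<^sup>\<smile> \<Zcomp> z)"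
  using rconv_le[OF dedekind_left[of "y\<^sup>\<smile>" "x\<^sup>\<smile>" "z\<^sup>\<smile>"]]
  by (simp add: rconv_rprod rconv_bprod rconv_rconv)

text \<open>\<open>v;1\<close> encodes the domain of \<open>v\<close>. It absorbs every further
  factor on the right, so restricting the domain of a product amounts to restricting that of its
  first factor.\<close>

lemma bprod_domain_rprod:
  assumes [simp]: "u \<in> carrier \<AA>" "v \<in> carrier \<AA>" "w \<in> carrier \<AA>"
  shows "(u \<cdot> v \<Zcomp> \<^bold>1) \<Zcomp> w = u \<Zcomp> w \<cdot> v \<Zcomp> \<^bold>1"
proof (rule le_antisym)
  have *: "v \<Zcomp> \<^bold>1 \<Zcomp> x \<preceq> v \<Zcomp> \<^bold>1" if [simp]: "x \<in> carrier \<AA>" for x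
    using rprod_le_right[OF le_bone, of "\<^bold>1 \<Zcomp> x" v] by (simp add: rprod_right_assoc)
  have "(u \<cdot> v \<Zcomp> \<^bold>1) \<Zcomp> w \<preceq> v \<Zcomp> \<^bold>1"
    by (rule le_trans[OF rprod_le_left[OF meet_le2] *]) auto
  then show "(u \<cdot> v \<Zcomp> \<^bold>1) \<Zcomp> w \<preceq> u \<Zcomp> w \<cdot> v \<Zcomp> \<^bold>1"
    by (intro le_meetI rprod_le_left meet_le1) auto
  have "u \<Zcomp> w \<cdot> v \<Zcomp> \<^bold>1 \<preceq> (u \<cdot> v \<Zcomp> \<^bold>1 \<Zcomp> w\<^sup>\<smile>) \<Zcomp> w"
    by (rule dedekind_left) auto
  moreover have "(u \<cdot> v \<Zcomp> \<^bold>1 \<Zcomp> w\<^sup>\<smile>) \<Zcomp> w \<preceq> (u \<cdot> v \<Zcomp> \<^bold>1) \<Zcomp> w"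
    by (intro rprod_le_left meet_mono * le_refl) auto
  ultimately show "u \<Zcomp> w \<cdot> v \<Zcomp> \<^bold>1 \<preceq> (u \<cdot> v \<Zcomp> \<^bold>1) \<Zcomp> w"
    by (rule le_trans) auto
qed auto

lemma functional_carrier [simp]: "functional \<AA> f \<Longrightarrow> f \<in> carrier \<AA>"
  by (simp add: functional_def)

lemma functional_le: "functional \<AA> f \<Longrightarrow> f\<^sup>\<smile> \<Zcomp> f \<preceq> \<^bold>1'"
  by (simp only: functional_def)

lemma functionalI: "\<lbrakk>f\<^sup>\<smile> \<Zcomp> f \<preceq> \<^bold>1'; f \<in> carrier \<AA>\<rbrakk> \<Longrightarrow> functional \<AA> f"
  by (simp only: functional_def)

lemma functional_rprod_le:
  assumes "functional \<AA> f" and [simp]: "x \<in> carrier \<AA>"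
  shows "f\<^sup>\<smile> \<Zcomp> (f \<Zcomp> x) \<preceq> x"
  using assms(1) rprod_le_left[OF functional_le[OF assms(1)], of x]
  by (simp add: rprod_right_assoc rid_rprod)

text \<open>Single-valuedness makes left composition preserve meets: Dedekind's law leaves a factor
  \<open>f\<^sup>\<smile>;(f;y)\<close>, which is below \<open>y\<close>.\<close>

lemma functional_bprod:
  assumes f: "functional \<AA> f" and [simp]: "x \<in> carrier \<AA>" "y \<in> carrier \<AA>"
  shows "f \<Zcomp> (x \<cdot> y) = f \<Zcomp> x \<cdot> f \<Zcomp> y"
proof (rule le_antisym)
  note [simp] = functional_carrier[OF f]
  show "f \<Zcomp> (x \<cdot> y) \<preceq> f \<Zcomp> x \<cdot> f \<Zcomp> y"
    by (intro le_meetI rprod_le_right meet_le1 meet_le2) auto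
  have "f \<Zcomp> x \<cdot> f \<Zcomp> y \<preceq> f \<Zcomp> (x \<cdot> f\<^sup>\<smile> \<Zcomp> (f \<Zcomp> y))"
    by (rule dedekind_right) auto
  moreover have "f \<Zcomp> (x \<cdot> f\<^sup>\<smile> \<Zcomp> (f \<Zcomp> y)) \<preceq> f \<Zcomp> (x \<cdot> y)"
    by (intro rprod_le_right meet_mono functional_rprod_le f le_refl) auto
  ultimately show "f \<Zcomp> x \<cdot> f \<Zcomp> y \<preceq> f \<Zcomp> (x \<cdot> y)"
    by (rule le_trans) auto
qed (use f in auto)

lemma bprod_rconv_functional:
  assumes f: "functional \<AA> f" and [simp]: "x \<in> carrier \<AA>" "y \<in> carrier \<AA>"
  shows "(x \<cdot> y) \<Zcomp> f\<^sup>\<smile> = x \<Zcomp> f\<^sup>\<smile> \<cdot> y \<Zcomp> f\<^sup>\<smile>"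
proof -
  note [simp] = functional_carrier[OF f]
  have "((x \<cdot> y) \<Zcomp> f\<^sup>\<smile>)\<^sup>\<smile> = (x \<Zcomp> f\<^sup>\<smile> \<cdot> y \<Zcomp> f\<^sup>\<smile>)\<^sup>\<smile>"
    using functional_bprod[OF f, of "x\<^sup>\<smile>" "y\<^sup>\<smile>"]
    by (simp add: rconv_rprod rconv_bprod rconv_rconv)
  then show ?thesis
    by (metis assms(2,3) \<open>f \<in> carrier \<AA>\<close> bprod_closed rconv_closed rconv_rconv rprod_closed)
qed

text \<open>For functional \<open>f\<close> Dedekind's inclusion becomes an equality, since
  \<open>f\<^sup>\<smile>;f\<close> lies below \<open>1'\<close>. With \<open>f\<close> a
  projection, this computes the components of a fork.\<close>

lemma bprod_rprod_functional:
  assumes f: "functional \<AA> f" and [simp]: "u \<in> carrier \<AA>" "v \<in> carrier \<AA>"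
  shows "(u \<cdot> v \<Zcomp> f\<^sup>\<smile>) \<Zcomp> f = u \<Zcomp> f \<cdot> v"
proof (rule le_antisym)
  note [simp] = functional_carrier[OF f]
  have "(u \<cdot> v \<Zcomp> f\<^sup>\<smile>) \<Zcomp> f \<preceq> v \<Zcomp> f\<^sup>\<smile> \<Zcomp> f"
    by (intro rprod_le_left meet_le2) auto
  moreover have "v \<Zcomp> f\<^sup>\<smile> \<Zcomp> f \<preceq> v"
    using rprod_le_right[OF functional_le[OF f], of v] by (simp add: rprod_right_assoc rprod_rid)
  ultimately have "(u \<cdot> v \<Zcomp> f\<^sup>\<smile>) \<Zcomp> f \<preceq> v"
    by (rule le_trans) auto
  then show "(u \<cdot> v \<Zcomp> f\<^sup>\<smile>) \<Zcomp> f \<preceq> u \<Zcomp> f \<cdot> v"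
    by (intro le_meetI rprod_le_left meet_le1) auto
  show "u \<Zcomp> f \<cdot> v \<preceq> (u \<cdot> v \<Zcomp> f\<^sup>\<smile>) \<Zcomp> f"
    by (rule dedekind_left) auto
qed (use f in auto)

lemma functional_rid [simp]: "functional \<AA> \<^bold>1'"
  by (rule functionalI) (simp_all add: rconv_rid rprod_rid le_refl)

lemma functional_rprod [simp]:
  assumes f: "functional \<AA> f" and g: "functional \<AA> g"
  shows "functional \<AA> (f \<Zcomp> g)"
proof -
  note [simp] = functional_carrier[OF f] functional_carrier[OF g]
  have "g\<^sup>\<smile> \<Zcomp> (f\<^sup>\<smile> \<Zcomp> (f \<Zcomp> g)) \<preceq> g\<^sup>\<smile> \<Zcomp> g"
    by (intro rprod_le_right functional_rprod_le f) auto
  moreover have "g\<^sup>\<smile> \<Zcomp> g \<preceq> \<^bold>1'"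
    using g by (rule functional_le)
  ultimately have "g\<^sup>\<smile> \<Zcomp> (f\<^sup>\<smile> \<Zcomp> (f \<Zcomp> g)) \<preceq> \<^bold>1'"
    by (rule le_trans) auto
  then show ?thesis
    by (intro functionalI) (simp_all add: rconv_rprod rprod_right_assoc)
qed

lemma permutational_functional: "permutational \<AA> f \<Longrightarrow> functional \<AA> f"
  by (rule functionalI) (simp_all add: permutational_def le_refl)

lemma permutational_rconv: "permutational \<AA> f \<Longrightarrow> permutational \<AA> (f\<^sup>\<smile>)"
  by (simp add: permutational_def rconv_rconv)

lemma permutational_rid: "permutational \<AA> \<^bold>1'"
  by (simp add: permutational_def rconv_rid rprod_rid)

lemma permutational_rprod:
  assumes "permutational \<AA> f" "permutational \<AA> g"
  shows "permutational \<AA> (f \<Zcomp> g)"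
proof -
  have [simp]: "f \<in> carrier \<AA>" "g \<in> carrier \<AA>"
    using assms by (simp_all add: permutational_def)
  have "g \<Zcomp> (g\<^sup>\<smile> \<Zcomp> f\<^sup>\<smile>) = f\<^sup>\<smile>" "f\<^sup>\<smile> \<Zcomp> (f \<Zcomp> g) = g"
    using assms by (simp_all add: permutational_def rprod_assoc rid_rprod)
  then show ?thesis
    using assms by (simp add: permutational_def rconv_rprod rprod_right_assoc)
qed

lemma monoid_Fn: "Group.monoid (Fn \<AA>)"
  by unfold_locales (auto simp: Fn_def rprod_right_assoc rid_rprod rprod_rid)

lemma group_Pm: "group (Pm \<AA>)"
proof (rule groupI)
  fix x assume "x \<in> carrier (Pm \<AA>)"
  then show "\<exists>y\<in>carrier (Pm \<AA>). y \<otimes>\<^bsub>Pm \<AA>\<^esub> x = \<one>\<^bsub>Pm \<AA>\<^esub>"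
    using permutational_rconv[of x] by (auto simp: Pm_def permutational_def)
next
  show "x \<otimes>\<^bsub>Pm \<AA>\<^esub> y \<in> carrier (Pm \<AA>)" if "x \<in> carrier (Pm \<AA>)" "y \<in> carrier (Pm \<AA>)" for x y
    using that permutational_rprod by (simp add: Pm_def)
  show "\<one>\<^bsub>Pm \<AA>\<^esub> \<in> carrier (Pm \<AA>)"
    using permutational_rid by (simp add: Pm_def)
qed (auto simp: Pm_def rprod_right_assoc rid_rprod permutational_def)

lemma inv_Pm:
  assumes "permutational \<AA> x"
  shows "inv\<^bsub>Pm \<AA>\<^esub> x = x\<^sup>\<smile>"
  by (rule group.inv_equality[OF group_Pm])
    (use assms permutational_rconv in \<open>auto simp: Pm_def permutational_def\<close>)

end

section \<open>Pairing with a pair of projections\<close>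

text \<open>On relations, \<open>a_conv_a\<close> and \<open>b_conv_b\<close> say that the
  projections are single-valued and onto, \<open>a_b_id\<close> that a point is determined by its
  two components, and \<open>a_conv_b\<close> that any two components belong to some point.\<close>

locale projection_pair = j_algebra +
  fixes a b :: 'a
  assumes a_closed [simp, intro]: "a \<in> carrier \<AA>"
    and b_closed [simp, intro]: "b \<in> carrier \<AA>"
    and a_conv_a: "a\<^sup>\<smile> \<Zcomp> a = \<^bold>1'"
    and b_conv_b: "b\<^sup>\<smile> \<Zcomp> b = \<^bold>1'"
    and a_b_id: "a \<Zcomp> a\<^sup>\<smile> \<cdot> b \<Zcomp> b\<^sup>\<smile> = \<^bold>1'"
    and a_conv_b: "a\<^sup>\<smile> \<Zcomp> b = \<^bold>1"
    and a_total: "a \<Zcomp> \<^bold>1 = \<^bold>1"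
    and b_total: "b \<Zcomp> \<^bold>1 = \<^bold>1"
begin

definition total_fn :: "'a \<Rightarrow> bool"
  where "total_fn x \<longleftrightarrow> functional \<AA> x \<and> x \<Zcomp> \<^bold>1 = \<^bold>1"

text \<open>On maps, \<open>s\<close> is sent to the pair of its values under \<open>x\<close> and
  \<open>y\<close>, wherever both are defined.\<close>

definition fork :: "'a \<Rightarrow> 'a \<Rightarrow> 'a"
  where "fork x y = x \<Zcomp> a\<^sup>\<smile> \<cdot> y \<Zcomp> b\<^sup>\<smile>"

definition defer\<^sub>0 :: "'a \<Rightarrow> 'a"
  where "defer\<^sub>0 x = fork (a \<Zcomp> x) b"

definition defer\<^sub>1 :: "'a \<Rightarrow> 'a"
  where "defer\<^sub>1 x = fork a (b \<Zcomp> x)"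

lemma functional_a [simp]: "functional \<AA> a" and functional_b [simp]: "functional \<AA> b"
  by (auto intro!: functionalI simp: a_conv_a b_conv_b le_refl)

lemma b_conv_a: "b\<^sup>\<smile> \<Zcomp> a = \<^bold>1"
  using rconv_rprod[of "a\<^sup>\<smile>" b] by (simp add: a_conv_b rconv_bone rconv_rconv)

lemma fork_closed [simp]: "\<lbrakk>x \<in> carrier \<AA>; y \<in> carrier \<AA>\<rbrakk> \<Longrightarrow> fork x y \<in> carrier \<AA>"
  by (simp add: fork_def)

text \<open>Each component bounds the product by one factor of
  \<open>a;a\<^sup>\<smile> \<cdot> b;b\<^sup>\<smile> = 1'\<close>: in
  \<open>p;u\<^sup>\<smile>;u;p\<^sup>\<smile>\<close> the middle cancels.\<close>

lemma functional_fork [simp]: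
  assumes x: "functional \<AA> x" and y: "functional \<AA> y"
  shows "functional \<AA> (fork x y)"
proof (rule functionalI)
  note [simp] = functional_carrier[OF x] functional_carrier[OF y]
  have *: "(u \<Zcomp> p\<^sup>\<smile>)\<^sup>\<smile> \<Zcomp> (u \<Zcomp> p\<^sup>\<smile>) \<preceq> p \<Zcomp> p\<^sup>\<smile>"
    if u: "functional \<AA> u" and [simp]: "p \<in> carrier \<AA>" for u p
  proof -
    note [simp] = functional_carrier[OF u]
    have "p \<Zcomp> (u\<^sup>\<smile> \<Zcomp> (u \<Zcomp> p\<^sup>\<smile>)) \<preceq> p \<Zcomp> p\<^sup>\<smile>"
      by (intro rprod_le_right functional_rprod_le u) auto
    then show ?thesis
      by (simp add: rconv_rprod rconv_rconv rprod_right_assoc)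
  qed
  have mono: "z\<^sup>\<smile> \<Zcomp> z \<preceq> w\<^sup>\<smile> \<Zcomp> w"
    if "z \<preceq> w" and [simp]: "z \<in> carrier \<AA>" "w \<in> carrier \<AA>" for z w
    by (rule le_trans[OF rprod_le_left[OF rconv_le[OF that]] rprod_le_right[OF that(1)]]) auto
  have "(fork x y)\<^sup>\<smile> \<Zcomp> fork x y \<preceq> a \<Zcomp> a\<^sup>\<smile> \<cdot> b \<Zcomp> b\<^sup>\<smile>"
  proof (rule le_meetI)
    show "(fork x y)\<^sup>\<smile> \<Zcomp> fork x y \<preceq> a \<Zcomp> a\<^sup>\<smile>"
      by (rule le_trans[OF mono *[OF x]]) (auto simp: fork_def meet_le1)
    show "(fork x y)\<^sup>\<smile> \<Zcomp> fork x y \<preceq> b \<Zcomp> b\<^sup>\<smile>"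
      by (rule le_trans[OF mono *[OF y]]) (auto simp: fork_def meet_le2)
  qed (auto simp: fork_def)
  then show "(fork x y)\<^sup>\<smile> \<Zcomp> fork x y \<preceq> \<^bold>1'"
    by (simp add: a_b_id)
qed (use x y in auto)

text \<open>Because \<open>b\<^sup>\<smile>;a = 1\<close>, the second component enters only through
  its domain. The factors are swapped so that the one ending in \<open>a\<^sup>\<smile>\<close>
  stands where \<open>bprod_rprod_functional\<close> cancels it.\<close>

lemma fork_a:
  assumes [simp]: "x \<in> carrier \<AA>" "y \<in> carrier \<AA>"
  shows "fork x y \<Zcomp> a = x \<cdot> y \<Zcomp> \<^bold>1"
proof -
  have "fork x y \<Zcomp> a = (y \<Zcomp> b\<^sup>\<smile> \<cdot> x \<Zcomp> a\<^sup>\<smile>) \<Zcomp> a"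
    by (simp add: fork_def bprod_comm)
  also have "\<dots> = x \<cdot> y \<Zcomp> \<^bold>1"
    by (simp add: bprod_rprod_functional rprod_right_assoc b_conv_a bprod_comm[of x])
  finally show ?thesis .
qed

lemma fork_b:
  assumes [simp]: "x \<in> carrier \<AA>" "y \<in> carrier \<AA>"
  shows "fork x y \<Zcomp> b = y \<cdot> x \<Zcomp> \<^bold>1"
  by (simp add: fork_def bprod_rprod_functional rprod_right_assoc a_conv_b bprod_comm[of y])

lemma functional_rprod_fork:
  assumes "functional \<AA> z" and [simp]: "x \<in> carrier \<AA>" "y \<in> carrier \<AA>"
  shows "z \<Zcomp> fork x y = fork (z \<Zcomp> x) (z \<Zcomp> y)"
  using assms(1) by (simp add: fork_def functional_bprod rprod_assoc)

text \<open>\<open>z\<close> is distributed over the decomposition of \<open>1'\<close> given by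
  \<open>a_b_id\<close>, so partial elements are covered too.\<close>

lemma fork_surjective: "functional \<AA> z \<Longrightarrow> fork (z \<Zcomp> a) (z \<Zcomp> b) = z"
  using functional_rprod_fork[of z a b] by (simp add: fork_def a_b_id rprod_rid)

lemma functional_eqI:
  "\<lbrakk>functional \<AA> x; functional \<AA> y; x \<Zcomp> a = y \<Zcomp> a; x \<Zcomp> b = y \<Zcomp> b\<rbrakk> \<Longrightarrow> x = y"
  by (metis fork_surjective)

lemma functional_defer [simp]:
  "functional \<AA> x \<Longrightarrow> functional \<AA> (defer\<^sub>0 x)"
  "functional \<AA> x \<Longrightarrow> functional \<AA> (defer\<^sub>1 x)"
  by (simp_all add: defer\<^sub>0_def defer\<^sub>1_def)

lemma rprod_domain:
  assumes [simp]: "x \<in> carrier \<AA>" "y \<in> carrier \<AA>"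
  shows "x \<Zcomp> y \<cdot> x \<Zcomp> \<^bold>1 = x \<Zcomp> y"
  using rprod_le_right[OF le_bone, of y x] by (simp add: rle_def)

text \<open>A fork already lives on the common domain of its arguments, so cutting each argument
  down to the domain of the other changes nothing.\<close>

lemma fork_restrict_domains:
  assumes [simp]: "x \<in> carrier \<AA>" "y \<in> carrier \<AA>" "u \<in> carrier \<AA>" "v \<in> carrier \<AA>"
  shows "fork ((x \<cdot> y \<Zcomp> \<^bold>1) \<Zcomp> u) ((y \<cdot> x \<Zcomp> \<^bold>1) \<Zcomp> v) = fork (x \<Zcomp> u) (y \<Zcomp> v)"
proof -
  have "fork ((x \<cdot> y \<Zcomp> \<^bold>1) \<Zcomp> u) ((y \<cdot> x \<Zcomp> \<^bold>1) \<Zcomp> v) =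
      (x \<Zcomp> (u \<Zcomp> a\<^sup>\<smile>) \<cdot> y \<Zcomp> \<^bold>1) \<cdot> (y \<Zcomp> (v \<Zcomp> b\<^sup>\<smile>) \<cdot> x \<Zcomp> \<^bold>1)"
    by (simp add: fork_def bprod_domain_rprod rprod_right_assoc)
  also have "\<dots> = (x \<Zcomp> (u \<Zcomp> a\<^sup>\<smile>) \<cdot> x \<Zcomp> \<^bold>1) \<cdot> (y \<Zcomp> (v \<Zcomp> b\<^sup>\<smile>) \<cdot> y \<Zcomp> \<^bold>1)"
    by (simp add: bprod_ac)
  also have "\<dots> = fork (x \<Zcomp> u) (y \<Zcomp> v)"
    by (simp add: rprod_domain fork_def rprod_right_assoc)
  finally show ?thesis .
qed

text \<open>The components of \<open>fork x y\<close> are \<open>x\<close> and \<open>y\<close>,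
  each cut down to the domain of the other. The cuts disappear when the components are paired again,
  which is why no totality is assumed.\<close>

lemma fork_defer:
  assumes x: "functional \<AA> x" and y: "functional \<AA> y" and u: "functional \<AA> u"
  shows fork_defer\<^sub>0: "fork x y \<Zcomp> defer\<^sub>0 u = fork (x \<Zcomp> u) y"
    and fork_defer\<^sub>1: "fork x y \<Zcomp> defer\<^sub>1 u = fork x (y \<Zcomp> u)"
proof -
  note [simp] = functional_carrier[OF x] functional_carrier[OF y] functional_carrier[OF u]
  have "fork x y \<Zcomp> fork (a \<Zcomp> p) (b \<Zcomp> q) = fork (x \<Zcomp> p) (y \<Zcomp> q)"
    if [simp]: "p \<in> carrier \<AA>" "q \<in> carrier \<AA>" for p q
    using x y by (simp add: functional_rprod_fork rprod_assoc fork_a fork_b fork_restrict_domains)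
  from this[of u "\<^bold>1'"] this[of "\<^bold>1'" u]
  show "fork x y \<Zcomp> defer\<^sub>0 u = fork (x \<Zcomp> u) y" "fork x y \<Zcomp> defer\<^sub>1 u = fork x (y \<Zcomp> u)"
    by (simp_all add: defer\<^sub>0_def defer\<^sub>1_def rprod_rid)
qed

lemma defer_rid: "defer\<^sub>0 \<^bold>1' = \<^bold>1'" "defer\<^sub>1 \<^bold>1' = \<^bold>1'"
  by (simp_all add: defer\<^sub>0_def defer\<^sub>1_def fork_def rprod_rid a_b_id)

lemma defer_rprod:
  assumes "functional \<AA> x" "functional \<AA> y"
  shows "defer\<^sub>0 (x \<Zcomp> y) = defer\<^sub>0 x \<Zcomp> defer\<^sub>0 y" "defer\<^sub>1 (x \<Zcomp> y) = defer\<^sub>1 x \<Zcomp> defer\<^sub>1 y"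
  using assms fork_defer\<^sub>0[of "a \<Zcomp> x" b y] fork_defer\<^sub>1[of a "b \<Zcomp> x" y]
  by (simp_all add: defer\<^sub>0_def[of "x \<Zcomp> y"] defer\<^sub>0_def[of x] defer\<^sub>1_def[of "x \<Zcomp> y"] defer\<^sub>1_def[of x]
      rprod_assoc)

text \<open>Both products are \<open>fork (a;x) (b;y)\<close>.\<close>

lemma defer_commute:
  assumes "functional \<AA> x" "functional \<AA> y"
  shows "defer\<^sub>0 x \<Zcomp> defer\<^sub>1 y = defer\<^sub>1 y \<Zcomp> defer\<^sub>0 x"
  using assms fork_defer\<^sub>1[of "a \<Zcomp> x" b y] fork_defer\<^sub>0[of a "b \<Zcomp> y" x]
  by (simp add: defer\<^sub>0_def[of x] defer\<^sub>1_def[of y])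

lemma rconv_defer:
  assumes "x \<in> carrier \<AA>"
  shows "(defer\<^sub>0 x)\<^sup>\<smile> = defer\<^sub>0 (x\<^sup>\<smile>)" "(defer\<^sub>1 x)\<^sup>\<smile> = defer\<^sub>1 (x\<^sup>\<smile>)"
  using assms
  by (simp_all add: defer\<^sub>0_def defer\<^sub>1_def fork_def rconv_bprod rconv_rprod rconv_rconv rprod_assoc)

lemma permutational_defer:
  assumes x: "permutational \<AA> x"
  shows "permutational \<AA> (defer\<^sub>0 x)" "permutational \<AA> (defer\<^sub>1 x)"
proof -
  have f [simp]: "functional \<AA> x" "functional \<AA> (x\<^sup>\<smile>)"
    using x by (auto intro: permutational_functional permutational_rconv)
  have "defer\<^sub>0 x \<Zcomp> defer\<^sub>0 (x\<^sup>\<smile>) = \<^bold>1'" "defer\<^sub>0 (x\<^sup>\<smile>) \<Zcomp> defer\<^sub>0 x = \<^bold>1'"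
    "defer\<^sub>1 x \<Zcomp> defer\<^sub>1 (x\<^sup>\<smile>) = \<^bold>1'" "defer\<^sub>1 (x\<^sup>\<smile>) \<Zcomp> defer\<^sub>1 x = \<^bold>1'"
    using x by (simp_all flip: defer_rprod add: permutational_def defer_rid)
  then show "permutational \<AA> (defer\<^sub>0 x)" "permutational \<AA> (defer\<^sub>1 x)"
    by (simp_all add: permutational_def rconv_defer)
qed

section \<open>Total elements and the named rearrangements\<close>

lemma total_functional [simp]: "total_fn x \<Longrightarrow> functional \<AA> x"
  by (simp add: total_fn_def)

lemma total_bone: "total_fn x \<Longrightarrow> x \<Zcomp> \<^bold>1 = \<^bold>1"
  by (simp add: total_fn_def)

lemma total_a [simp]: "total_fn a" and total_b [simp]: "total_fn b" and total_rid [simp]: "total_fn \<^bold>1'"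
  by (simp_all add: total_fn_def a_total b_total rid_rprod)

lemma total_rprod [simp]: "\<lbrakk>total_fn x; total_fn y\<rbrakk> \<Longrightarrow> total_fn (x \<Zcomp> y)"
  unfolding total_fn_def by (simp add: rprod_right_assoc)

lemma total_fork_a: "\<lbrakk>total_fn x; total_fn y\<rbrakk> \<Longrightarrow> fork x y \<Zcomp> a = x"
  by (simp add: fork_a total_bone bprod_bone)

lemma total_fork_b: "\<lbrakk>total_fn x; total_fn y\<rbrakk> \<Longrightarrow> fork x y \<Zcomp> b = y"
  by (simp add: fork_b total_bone bprod_bone)

lemma total_fork [simp]:
  assumes x: "total_fn x" and y: "total_fn y"
  shows "total_fn (fork x y)"
proof -
  have "fork x y \<Zcomp> \<^bold>1 = fork x y \<Zcomp> a \<Zcomp> \<^bold>1"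
    using x y by (simp add: rprod_right_assoc a_total)
  also have "\<dots> = \<^bold>1"
    using x y by (simp add: total_fork_a total_bone)
  finally show ?thesis
    using x y by (simp add: total_fn_def)
qed

lemma total_defer [simp]: "total_fn x \<Longrightarrow> total_fn (defer\<^sub>0 x)" "total_fn x \<Longrightarrow> total_fn (defer\<^sub>1 x)"
  by (simp_all add: defer\<^sub>0_def defer\<^sub>1_def)

text \<open>On nested pairs, \<open>U\<close> duplicates \<open>p\<close> to \<open>(p,p)\<close>,
  \<open>P\<close> swaps \<open>(p,q)\<close> to \<open>(q,p)\<close>, and \<open>R\<close>,
  \<open>C\<close>, \<open>\<pi>\<^sub>0\<close> take \<open>(p,(q,r))\<close> to
  \<open>((p,q),r)\<close>, \<open>(q,(r,p))\<close> and \<open>(q,(p,r))\<close>.\<close>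

definition U :: 'a where "U = fork \<^bold>1' \<^bold>1'"
definition P :: 'a where "P = fork b a"
definition R :: 'a where "R = fork (fork a (b \<Zcomp> a)) (b \<Zcomp> b)"
definition C :: 'a where "C = fork (b \<Zcomp> a) (fork (b \<Zcomp> b) a)"
definition \<pi>\<^sub>0 :: 'a where "\<pi>\<^sub>0 = fork (b \<Zcomp> a) (fork a (b \<Zcomp> b))"

lemma total_generators [simp]: "total_fn U" "total_fn P" "total_fn R" "total_fn C" "total_fn \<pi>\<^sub>0"
  by (simp_all add: U_def P_def R_def C_def \<pi>\<^sub>0_def)

text \<open>Right multiplication by the converse of a projection distributes over meets, so nested
  forks flatten into threefold meets. In this form they match the given formulas, and converses can
  be read off factor by factor.\<close>

lemma fork_fork_left:
  "\<lbrakk>x \<in> carrier \<AA>; y \<in> carrier \<AA>; z \<in> carrier \<AA>\<rbrakk> \<Longrightarrow>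
    fork (fork x y) z = x \<Zcomp> a\<^sup>\<smile> \<Zcomp> a\<^sup>\<smile> \<cdot> y \<Zcomp> b\<^sup>\<smile> \<Zcomp> a\<^sup>\<smile> \<cdot> z \<Zcomp> b\<^sup>\<smile>"
  by (simp add: fork_def bprod_rconv_functional)

lemma fork_fork_right:
  "\<lbrakk>x \<in> carrier \<AA>; y \<in> carrier \<AA>; z \<in> carrier \<AA>\<rbrakk> \<Longrightarrow>
    fork x (fork y z) = x \<Zcomp> a\<^sup>\<smile> \<cdot> (y \<Zcomp> a\<^sup>\<smile> \<Zcomp> b\<^sup>\<smile> \<cdot> z \<Zcomp> b\<^sup>\<smile> \<Zcomp> b\<^sup>\<smile>)"
  by (simp add: fork_def bprod_rconv_functional)

lemma rconv_P: "P\<^sup>\<smile> = P"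
  by (simp add: P_def fork_def rconv_bprod rconv_rprod rconv_rconv bprod_comm)

lemma rconv_R: "R\<^sup>\<smile> = fork (a \<Zcomp> a) (fork (a \<Zcomp> b) b)"
  by (simp add: R_def fork_fork_left fork_fork_right rconv_bprod rconv_rprod rconv_rconv
      rprod_right_assoc bprod_ac)

lemma rconv_C: "C\<^sup>\<smile> = fork (b \<Zcomp> b) (fork a (b \<Zcomp> a))"
  by (simp add: C_def fork_fork_right rconv_bprod rconv_rprod rconv_rconv
      rprod_right_assoc bprod_ac)

lemma rconv_\<pi>\<^sub>0: "\<pi>\<^sub>0\<^sup>\<smile> = \<pi>\<^sub>0"
  by (simp add: \<pi>\<^sub>0_def fork_fork_right rconv_bprod rconv_rprod rconv_rconv
      rprod_right_assoc bprod_ac)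

end

section \<open>The relations of Thompson's groups\<close>

context projection_pair
begin

text \<open>Products are kept associated to the right. A value of \<open>f\<close> on a leaf word
  must then also apply when that word is a proper prefix of what follows; there is one version for
  each length of the word.\<close>

lemma rprod_extend1: "\<lbrakk>f \<Zcomp> p = q; f \<in> carrier \<AA>; p \<in> carrier \<AA>; z \<in> carrier \<AA>\<rbrakk> \<Longrightarrow> f \<Zcomp> (p \<Zcomp> z) = q \<Zcomp> z"
  by (simp add: rprod_assoc)

lemma rprod_extend2:
  "\<lbrakk>f \<Zcomp> (p \<Zcomp> r) = q; f \<in> carrier \<AA>; p \<in> carrier \<AA>; r \<in> carrier \<AA>; z \<in> carrier \<AA>\<rbrakk> \<Longrightarrow>
    f \<Zcomp> (p \<Zcomp> (r \<Zcomp> z)) = q \<Zcomp> z"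
  by (simp add: rprod_assoc)

lemma rprod_extend3:
  "\<lbrakk>f \<Zcomp> (p \<Zcomp> (r \<Zcomp> s)) = q; f \<in> carrier \<AA>; p \<in> carrier \<AA>; r \<in> carrier \<AA>; s \<in> carrier \<AA>;
    z \<in> carrier \<AA>\<rbrakk> \<Longrightarrow> f \<Zcomp> (p \<Zcomp> (r \<Zcomp> (s \<Zcomp> z))) = q \<Zcomp> z"
  by (simp add: rprod_assoc)

lemma table_U: "U \<Zcomp> a = \<^bold>1'" "U \<Zcomp> b = \<^bold>1'"
  by (simp_all add: U_def total_fork_a total_fork_b)

lemma table_P: "P \<Zcomp> a = b" "P \<Zcomp> b = a"
  by (simp_all add: P_def total_fork_a total_fork_b)

lemma table_defer\<^sub>0:
  assumes "total_fn x"
  shows "defer\<^sub>0 x \<Zcomp> a = a \<Zcomp> x" "defer\<^sub>0 x \<Zcomp> b = b"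
  using assms by (simp_all add: defer\<^sub>0_def total_fork_a total_fork_b)

lemma table_defer\<^sub>1:
  assumes "total_fn x"
  shows "defer\<^sub>1 x \<Zcomp> a = a" "defer\<^sub>1 x \<Zcomp> b = b \<Zcomp> x"
  using assms by (simp_all add: defer\<^sub>1_def total_fork_a total_fork_b)

text \<open>\<open>R\<close> is tabulated on the leaf words of \<open>((p,q),r)\<close>. There is no
  entry for \<open>R;a\<close>, which is a pairing and not a word in \<open>a\<close> and
  \<open>b\<close>.\<close>

lemma table_R: "R \<Zcomp> b = b \<Zcomp> b" "R \<Zcomp> (a \<Zcomp> a) = a" "R \<Zcomp> (a \<Zcomp> b) = b \<Zcomp> a"
  by (simp_all add: R_def total_fork_a total_fork_b rprod_assoc)

lemma table_R_conv: "R\<^sup>\<smile> \<Zcomp> a = a \<Zcomp> a" "R\<^sup>\<smile> \<Zcomp> (b \<Zcomp> a) = a \<Zcomp> b" "R\<^sup>\<smile> \<Zcomp> (b \<Zcomp> b) = b"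
  by (simp_all add: rconv_R total_fork_a total_fork_b rprod_assoc)

lemma table_C: "C \<Zcomp> a = b \<Zcomp> a" "C \<Zcomp> (b \<Zcomp> a) = b \<Zcomp> b" "C \<Zcomp> (b \<Zcomp> b) = a"
  by (simp_all add: C_def total_fork_a total_fork_b rprod_assoc)

lemma table_C_conv: "C\<^sup>\<smile> \<Zcomp> a = b \<Zcomp> b" "C\<^sup>\<smile> \<Zcomp> (b \<Zcomp> a) = a" "C\<^sup>\<smile> \<Zcomp> (b \<Zcomp> b) = b \<Zcomp> a"
  by (simp_all add: rconv_C total_fork_a total_fork_b rprod_assoc)

lemma table_\<pi>\<^sub>0: "\<pi>\<^sub>0 \<Zcomp> a = b \<Zcomp> a" "\<pi>\<^sub>0 \<Zcomp> (b \<Zcomp> a) = a" "\<pi>\<^sub>0 \<Zcomp> (b \<Zcomp> b) = b \<Zcomp> b"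
  by (simp_all add: \<pi>\<^sub>0_def total_fork_a total_fork_b rprod_assoc)

lemma total_rconv [simp]: "total_fn (R\<^sup>\<smile>)" "total_fn (C\<^sup>\<smile>)"
  by (simp_all add: rconv_R rconv_C)

lemmas tables =
  table_U table_U[THEN rprod_extend1] table_P table_P[THEN rprod_extend1]
  table_defer\<^sub>0 table_defer\<^sub>0[THEN rprod_extend1]
  table_defer\<^sub>1 table_defer\<^sub>1[THEN rprod_extend1]
  table_R table_R(1)[THEN rprod_extend1] table_R(2-)[THEN rprod_extend2]
  table_R_conv table_R_conv(1)[THEN rprod_extend1] table_R_conv(2-)[THEN rprod_extend2]
  table_C table_C(1)[THEN rprod_extend1] table_C(2-)[THEN rprod_extend2]
  table_C_conv table_C_conv(1)[THEN rprod_extend1] table_C_conv(2-)[THEN rprod_extend2]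
  table_\<pi>\<^sub>0 table_\<pi>\<^sub>0(1)[THEN rprod_extend1] table_\<pi>\<^sub>0(2-)[THEN rprod_extend2]
  rid_rprod rprod_rid rprod_right_assoc

definition B :: 'a where "B = defer\<^sub>1 R"
definition X\<^sub>2 :: 'a where "X\<^sub>2 = R \<Zcomp> B \<Zcomp> R\<^sup>\<smile>"
definition X\<^sub>3 :: 'a where "X\<^sub>3 = (R \<Zcomp> R) \<Zcomp> B \<Zcomp> (R\<^sup>\<smile> \<Zcomp> R\<^sup>\<smile>)"
definition C\<^sub>2 :: 'a where "C\<^sub>2 = B \<Zcomp> C \<Zcomp> R\<^sup>\<smile>"
definition C\<^sub>3 :: 'a where "C\<^sub>3 = (B \<Zcomp> B) \<Zcomp> C \<Zcomp> (R\<^sup>\<smile> \<Zcomp> R\<^sup>\<smile>)"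
definition \<pi>\<^sub>1 :: 'a where "\<pi>\<^sub>1 = C\<^sub>2 \<Zcomp> \<pi>\<^sub>0 \<Zcomp> C\<^sub>2\<^sup>\<smile>"
definition \<pi>\<^sub>2 :: 'a where "\<pi>\<^sub>2 = R \<Zcomp> \<pi>\<^sub>1 \<Zcomp> R\<^sup>\<smile>"
definition \<pi>\<^sub>3 :: 'a where "\<pi>\<^sub>3 = (R \<Zcomp> R) \<Zcomp> \<pi>\<^sub>1 \<Zcomp> (R\<^sup>\<smile> \<Zcomp> R\<^sup>\<smile>)"

lemma rconv_B: "B\<^sup>\<smile> = defer\<^sub>1 (R\<^sup>\<smile>)"
  by (simp add: B_def rconv_defer)

lemma permutational_P: "permutational \<AA> P"
proof -
  have "P \<Zcomp> P = \<^bold>1'"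
    \<comment> \<open>An equation that the tables do not settle is split by appending
      \<open>a\<close> and \<open>b\<close>, one level down the binary tree. Branches end at
      different depths, as soon as all the words are long enough.\<close>
    by ((simp add: tables; fail) | rule functional_eqI)+
  then show ?thesis
    by (simp add: permutational_def rconv_P)
qed

lemma permutational_R: "permutational \<AA> R"
proof -
  have "R \<Zcomp> R\<^sup>\<smile> = \<^bold>1'" "R\<^sup>\<smile> \<Zcomp> R = \<^bold>1'"
    by ((simp add: tables; fail) | rule functional_eqI)+
  then show ?thesis
    by (simp add: permutational_def)
qed

lemma permutational_C: "permutational \<AA> C"
proof -
  have "C \<Zcomp> C\<^sup>\<smile> = \<^bold>1'" "C\<^sup>\<smile> \<Zcomp> C = \<^bold>1'"
    by ((simp add: tables; fail) | rule functional_eqI)+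
  then show ?thesis
    by (simp add: permutational_def)
qed

lemma permutational_\<pi>\<^sub>0: "permutational \<AA> \<pi>\<^sub>0"
proof -
  have "\<pi>\<^sub>0 \<Zcomp> \<pi>\<^sub>0 = \<^bold>1'"
    by ((simp add: tables; fail) | rule functional_eqI)+
  then show ?thesis
    by (simp add: permutational_def rconv_\<pi>\<^sub>0)
qed

lemma permutational_B: "permutational \<AA> B"
  by (simp add: B_def permutational_defer permutational_R)

text \<open>Conjugation by \<open>R\<close> exposes \<open>r\<close> in \<open>(p,(q,r))\<close> as
  a second component, so an action on the second component moves one level deeper. The same shift
  gives \<open>X\<^sub>3\<close>, \<open>\<pi>\<^sub>2\<close> and
  \<open>\<pi>\<^sub>3\<close>.\<close>

lemma X\<^sub>2_eq: "X\<^sub>2 = defer\<^sub>1 B"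
  unfolding X\<^sub>2_def B_def by ((simp add: tables; fail) | rule functional_eqI)+

lemma X\<^sub>3_eq: "X\<^sub>3 = defer\<^sub>1 X\<^sub>2"
  unfolding X\<^sub>3_def X\<^sub>2_eq unfolding B_def by ((simp add: tables; fail) | rule functional_eqI)+

lemma total_C\<^sub>2 [simp]: "total_fn C\<^sub>2" "total_fn (C\<^sub>2\<^sup>\<smile>)"
  by (simp_all add: C\<^sub>2_def B_def rconv_rprod rconv_rconv rconv_defer)

text \<open>\<open>C\<^sub>2\<close> rotates \<open>(p,(q,(r,s)))\<close> to
  \<open>(q,(r,(s,p)))\<close>, the counterpart of \<open>C\<close> on four leaves.\<close>

lemma table_C\<^sub>2:
  "C\<^sub>2 \<Zcomp> a = b \<Zcomp> a" "C\<^sub>2 \<Zcomp> (b \<Zcomp> a) = b \<Zcomp> (b \<Zcomp> a)"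
  "C\<^sub>2 \<Zcomp> (b \<Zcomp> (b \<Zcomp> a)) = b \<Zcomp> (b \<Zcomp> b)" "C\<^sub>2 \<Zcomp> (b \<Zcomp> (b \<Zcomp> b)) = a"
  by (simp_all add: C\<^sub>2_def B_def tables)

lemma table_C\<^sub>2_conv:
  "C\<^sub>2\<^sup>\<smile> \<Zcomp> a = b \<Zcomp> (b \<Zcomp> b)" "C\<^sub>2\<^sup>\<smile> \<Zcomp> (b \<Zcomp> a) = a"
  "C\<^sub>2\<^sup>\<smile> \<Zcomp> (b \<Zcomp> (b \<Zcomp> a)) = b \<Zcomp> a" "C\<^sub>2\<^sup>\<smile> \<Zcomp> (b \<Zcomp> (b \<Zcomp> b)) = b \<Zcomp> (b \<Zcomp> a)"
  by (simp_all add: C\<^sub>2_def B_def tables rconv_rprod rconv_rconv rconv_defer)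

lemmas tables' = tables
  table_C\<^sub>2 table_C\<^sub>2(1)[THEN rprod_extend1] table_C\<^sub>2(2)[THEN rprod_extend2] table_C\<^sub>2(3-)[THEN rprod_extend3]
  table_C\<^sub>2_conv table_C\<^sub>2_conv(1)[THEN rprod_extend1] table_C\<^sub>2_conv(2)[THEN rprod_extend2]
  table_C\<^sub>2_conv(3-)[THEN rprod_extend3]

text \<open>Conjugating the exchange of the first two leaves by the rotation
  \<open>C\<^sub>2\<close> exchanges the second and the third.\<close>

lemma \<pi>\<^sub>1_eq: "\<pi>\<^sub>1 = defer\<^sub>1 \<pi>\<^sub>0"
  unfolding \<pi>\<^sub>1_def by ((simp add: tables'; fail) | rule functional_eqI)+

lemma \<pi>\<^sub>2_eq: "\<pi>\<^sub>2 = defer\<^sub>1 \<pi>\<^sub>1"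
  unfolding \<pi>\<^sub>2_def \<pi>\<^sub>1_eq by ((simp add: tables; fail) | rule functional_eqI)+

lemma \<pi>\<^sub>3_eq: "\<pi>\<^sub>3 = defer\<^sub>1 \<pi>\<^sub>2"
  unfolding \<pi>\<^sub>3_def \<pi>\<^sub>2_eq \<pi>\<^sub>1_eq by ((simp add: tables; fail) | rule functional_eqI)+

lemma C\<^sub>3_eq: "C\<^sub>3 = B \<Zcomp> (B \<Zcomp> (C \<Zcomp> (R\<^sup>\<smile> \<Zcomp> R\<^sup>\<smile>)))"
  by (simp add: C\<^sub>3_def B_def rprod_right_assoc)

text \<open>The two commutator relations are stated as commutation. They hold because
  \<open>B\<^sup>\<smile>;R\<close> leaves the component \<open>b;b\<close> fixed, while
  \<open>X\<^sub>2\<close> and \<open>X\<^sub>3\<close> act inside that component.\<close>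

lemma group_relations:
  "(B\<^sup>\<smile> \<Zcomp> R) \<Zcomp> X\<^sub>2 = X\<^sub>2 \<Zcomp> (B\<^sup>\<smile> \<Zcomp> R)"
  "(B\<^sup>\<smile> \<Zcomp> R) \<Zcomp> X\<^sub>3 = X\<^sub>3 \<Zcomp> (B\<^sup>\<smile> \<Zcomp> R)"
  "C = C\<^sub>2 \<Zcomp> B"
  "X\<^sub>2 \<Zcomp> C\<^sub>2 = C\<^sub>3 \<Zcomp> B"
  "R \<Zcomp> C = C\<^sub>2 \<Zcomp> C\<^sub>2"
  "C \<Zcomp> C \<Zcomp> C = \<^bold>1'"
  "\<pi>\<^sub>1 \<Zcomp> \<pi>\<^sub>1 = \<^bold>1'"
  "\<pi>\<^sub>3 \<Zcomp> \<pi>\<^sub>1 = \<pi>\<^sub>1 \<Zcomp> \<pi>\<^sub>3"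
  "(\<pi>\<^sub>1 \<Zcomp> \<pi>\<^sub>2) \<Zcomp> (\<pi>\<^sub>1 \<Zcomp> \<pi>\<^sub>2) \<Zcomp> (\<pi>\<^sub>1 \<Zcomp> \<pi>\<^sub>2) = \<^bold>1'"
  "\<pi>\<^sub>1 \<Zcomp> X\<^sub>3 = X\<^sub>3 \<Zcomp> \<pi>\<^sub>1"
  "X\<^sub>2 \<Zcomp> \<pi>\<^sub>1 = \<pi>\<^sub>1 \<Zcomp> \<pi>\<^sub>2 \<Zcomp> B"
  "B \<Zcomp> \<pi>\<^sub>2 = \<pi>\<^sub>3 \<Zcomp> B"
  "C\<^sub>3 \<Zcomp> \<pi>\<^sub>1 = \<pi>\<^sub>2 \<Zcomp> C\<^sub>3"
  "(C\<^sub>2 \<Zcomp> \<pi>\<^sub>1) \<Zcomp> (C\<^sub>2 \<Zcomp> \<pi>\<^sub>1) \<Zcomp> (C\<^sub>2 \<Zcomp> \<pi>\<^sub>1) = \<^bold>1'"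
  unfolding \<pi>\<^sub>3_eq \<pi>\<^sub>2_eq \<pi>\<^sub>1_eq X\<^sub>3_eq X\<^sub>2_eq C\<^sub>3_eq rconv_B unfolding B_def
  by ((simp add: tables'; fail) | rule functional_eqI)+

end

section \<open>Images of presented monoids and groups\<close>

definition word_eval :: "('c, 'd) monoid_scheme \<Rightarrow> ('l \<Rightarrow> 'c) \<Rightarrow> 'l list \<Rightarrow> 'c"
  where "word_eval G f w = foldr (\<lambda>l x. f l \<otimes>\<^bsub>G\<^esub> x) w \<one>\<^bsub>G\<^esub>"

lemma word_eval_Nil [simp]: "word_eval G f [] = \<one>\<^bsub>G\<^esub>"
  and word_eval_Cons [simp]: "word_eval G f (l # w) = f l \<otimes>\<^bsub>G\<^esub> word_eval G f w"
  by (simp_all add: word_eval_def)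

context Group.monoid
begin

lemma word_eval_closed:
  assumes "f \<in> S \<rightarrow> carrier G" "w \<in> lists S"
  shows "word_eval G f w \<in> carrier G"
  using assms(2) by induction (use assms(1) in auto)

lemma word_eval_append:
  assumes "f \<in> S \<rightarrow> carrier G" "u \<in> lists S" "v \<in> lists S"
  shows "word_eval G f (u @ v) = word_eval G f u \<otimes> word_eval G f v"
  using assms(2)
proof induction
  case (Cons l w)
  then have "f l \<in> carrier G"
    using assms(1) by auto
  with Cons show ?case
    using word_eval_closed[OF assms(1)] assms(3) by (simp add: m_assoc)
qed (simp add: word_eval_closed[OF assms(1,3)])

lemma word_eval_pcong:
  assumes f: "f \<in> S \<rightarrow> carrier G"
    and R: "\<And>u v. (u, v) \<in> R \<Longrightarrow> u \<in> lists S \<and> v \<in> lists S \<and> word_eval G f u = word_eval G f v"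
    and "pcong S R u v"
  shows "u \<in> lists S \<and> v \<in> lists S \<and> word_eval G f u = word_eval G f v"
  using assms(3)
proof induction
  case (cong_app u u' v v')
  then show ?case
    using word_eval_append[OF f] by auto
qed (auto dest: R)

text \<open>Von Dyck's theorem for monoids. A congruence class has a single value, which
  \<open>the_elem\<close> extracts, and the target is cut down to the values of words so that the
  map is onto.\<close>

lemma presented_monoid_epi:
  assumes f: "f \<in> S \<rightarrow> carrier G"
    and R: "\<And>u v. (u, v) \<in> R \<Longrightarrow> u \<in> lists S \<and> v \<in> lists S \<and> word_eval G f u = word_eval G f v"
  shows "\<exists>h. h \<in> epi (presented_monoid S R) (G\<lparr>carrier := word_eval G f ` lists S\<rparr>) \<and>
    h \<one>\<^bsub>presented_monoid S R\<^esub> = \<one>"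
proof -
  let ?M = "presented_monoid S R"
  let ?cl = "\<lambda>u. {w. pcong S R u w}"
  define h where "h X = the_elem (word_eval G f ` X)" for X
  have h: "h (?cl u) = word_eval G f u" if "u \<in> lists S" for u
  proof -
    have "word_eval G f w = word_eval G f u" if "w \<in> ?cl u" for w
      using word_eval_pcong[OF f R, of R u w] that by simp
    moreover have "u \<in> ?cl u"
      using that by (simp add: pcong.cong_refl)
    ultimately have "word_eval G f ` ?cl u = {word_eval G f u}"
      by blast
    then show ?thesis
      by (simp add: h_def)
  qed
  have carrier: "carrier ?M = ?cl ` lists S"
    by (auto simp: presented_monoid_def quotient_def)
  have mult: "?cl u \<otimes>\<^bsub>?M\<^esub> ?cl v = ?cl (u @ v)" if "u \<in> lists S" "v \<in> lists S" for u v
  proof -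
    have *: "?cl (u' @ v') = ?cl (u @ v)" if "pcong S R u u'" "pcong S R v v'" for u' v'
      using that by (meson pcong.cong_app pcong.cong_sym pcong.cong_trans)
    have mem: "u \<in> ?cl u" "v \<in> ?cl v"
      using that by (simp_all add: pcong.cong_refl)
    have "?cl u \<otimes>\<^bsub>?M\<^esub> ?cl v = (\<Union>u'\<in>?cl u. \<Union>v'\<in>?cl v. ?cl (u' @ v'))"
      by (simp add: presented_monoid_def)
    also have "\<dots> = (\<Union>u'\<in>?cl u. \<Union>v'\<in>?cl v. ?cl (u @ v))"
      by (intro SUP_cong refl *) simp_all
    also have "\<dots> = ?cl (u @ v)"
      using mem by blast
    finally show ?thesis .
  qed
  have "h \<in> hom ?M (G\<lparr>carrier := word_eval G f ` lists S\<rparr>)"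
  proof (rule homI)
    fix X assume "X \<in> carrier ?M"
    then show "h X \<in> carrier (G\<lparr>carrier := word_eval G f ` lists S\<rparr>)"
      using h by (auto simp: carrier)
  next
    fix X Y assume "X \<in> carrier ?M" "Y \<in> carrier ?M"
    then obtain u v where "u \<in> lists S" "v \<in> lists S" "X = ?cl u" "Y = ?cl v"
      by (auto simp: carrier)
    then show "h (X \<otimes>\<^bsub>?M\<^esub> Y) = h X \<otimes>\<^bsub>G\<lparr>carrier := word_eval G f ` lists S\<rparr>\<^esub> h Y"
      by (simp add: mult h word_eval_append[OF f])
  qed
  moreover have "h ` carrier ?M = word_eval G f ` lists S"
    unfolding carrier image_image by (rule image_cong[OF refl h])
  moreover have "h \<one>\<^bsub>?M\<^esub> = \<one>"
    using h[of "[]"] by (simp add: presented_monoid_def)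
  ultimately show ?thesis
    unfolding epi_def by auto
qed

lemma submonoid_submonoid_generated: "submonoid (carrier (submonoid_generated G S)) G"
  unfolding submonoid_generated_def
  by unfold_locales (auto dest: submonoid.subset submonoid.m_closed submonoid.one_closed
      intro: submonoid.intro)

lemma submonoid_generated_incl:
  "\<lbrakk>x \<in> S; x \<in> carrier G\<rbrakk> \<Longrightarrow> x \<in> carrier (submonoid_generated G S)"
  unfolding submonoid_generated_def by auto

lemma submonoid_generated_minimal:
  "\<lbrakk>submonoid H G; S \<subseteq> H\<rbrakk> \<Longrightarrow> carrier (submonoid_generated G S) \<subseteq> H"
  unfolding submonoid_generated_def by auto

end

lemma submonoid_generated_carrier:
  "submonoid_generated G S = G\<lparr>carrier := carrier (submonoid_generated G S)\<rparr>"
  by (simp add: submonoid_generated_def)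

context group
begin

lemma word_eval_winv:
  assumes f: "f \<in> S \<times> UNIV \<rightarrow> carrier G" and inv: "\<And>g e. g \<in> S \<Longrightarrow> f (g, \<not> e) = inv f (g, e)"
    and "w \<in> lists (S \<times> UNIV)"
  shows "word_eval G f (winv w) = inv word_eval G f w"
  using assms(3)
proof induction
  case (Cons l w)
  obtain g e where l: "l = (g, e)" "g \<in> S"
    using Cons.hyps(1) by auto
  have c: "f (g, e) \<in> carrier G" "word_eval G f w \<in> carrier G"
    using f l Cons.hyps(2) by (auto intro: word_eval_closed)
  have "winv w \<in> lists (S \<times> UNIV)"
    using Cons.hyps(2) by (auto simp: winv_def)
  moreover have "winv (l # w) = winv w @ [(g, \<not> e)]"
    by (simp add: winv_def l)
  ultimately show ?case
    using l c Cons.IH word_eval_append[OF f, of "winv w" "[(g, \<not> e)]"]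
    by (simp add: inv inv_mult_group)
qed (simp add: winv_def)

text \<open>The image is described by the values of \<open>(g, False)\<close>, formally the inverse
  letters, because in the application those carry the named elements. Either sign generates the same
  subgroup.\<close>

lemma presented_group_image:
  assumes f: "f \<in> S \<times> UNIV \<rightarrow> carrier G"
    and inv: "\<And>g e. g \<in> S \<Longrightarrow> f (g, \<not> e) = inv f (g, e)"
    and R: "\<And>u v. (u, v) \<in> R \<Longrightarrow> u \<in> lists (S \<times> UNIV) \<and> v \<in> lists (S \<times> UNIV) \<and>
      word_eval G f u = word_eval G f v"
  shows "group_image (subgroup_generated G ((\<lambda>g. f (g, False)) ` S)) (presented_group S R)"
proof -
  let ?T = "(\<lambda>g. f (g, False)) ` S"
  let ?L = "lists (S \<times> (UNIV :: bool set))"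
  let ?R = "R \<union> {([(g, e), (g, \<not> e)], []) | g e. g \<in> S}"
  have "u \<in> ?L \<and> v \<in> ?L \<and> word_eval G f u = word_eval G f v" if "(u, v) \<in> ?R" for u v
    using that
  proof
    assume "(u, v) \<in> {([(g, e), (g, \<not> e)], []) | g e. g \<in> S}"
    then obtain g e where "u = [(g, e), (g, \<not> e)]" "v = []" "g \<in> S"
      by auto
    moreover from this have "f (g, e) \<in> carrier G"
      using f by auto
    ultimately show ?thesis
      by (simp add: inv)
  qed (rule R)
  from presented_monoid_epi[OF f this]
  obtain h where h: "h \<in> epi (presented_group S R) (G\<lparr>carrier := word_eval G f ` ?L\<rparr>)"
    unfolding presented_group_def by blast
  have "word_eval G f ` ?L = generate G ?T"
  proof (intro equalityI subsetI)
    fix x assume "x \<in> word_eval G f ` ?L"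
    then obtain w where w: "w \<in> ?L" and x: "x = word_eval G f w"
      by auto
    from w have "word_eval G f w \<in> generate G ?T"
    proof induction
      case Nil
      show ?case
        by (simp add: generate.one)
    next
      case (Cons l w)
      then obtain g e where l: "l = (g, e)" "g \<in> S"
        by auto
      then have "f (g, False) \<in> ?T"
        by auto
      then have "f (g, e) \<in> generate G ?T"
        using inv[of g False] l by (cases e) (auto intro: generate.incl generate.inv)
      then show ?case
        using Cons.IH l by (auto intro: generate.eng)
    qed
    then show "x \<in> generate G ?T"
      by (simp add: x)
  next
    fix x assume "x \<in> generate G ?T"
    then show "x \<in> word_eval G f ` ?L"
    proof induction
      case one
      show ?case
        by (rule image_eqI[of _ _ "[]"]) auto
    next
      case (incl h)
      then obtain g where "g \<in> S" "h = f (g, False)"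
        by auto
      moreover from this have "f (g, False) \<in> carrier G"
        using f by auto
      ultimately show ?case
        by (intro image_eqI[of _ _ "[(g, False)]"]) auto
    next
      case (inv h)
      then obtain g where g: "g \<in> S" "h = f (g, False)"
        by auto
      then have "inv h = f (g, True)"
        using assms(2)[of g False] by auto
      moreover have "f (g, True) \<in> carrier G"
        using f g by auto
      ultimately show ?case
        using g by (intro image_eqI[of _ _ "[(g, True)]"]) auto
    next
      case (eng h1 h2)
      then obtain u v where "u \<in> ?L" "v \<in> ?L" "h1 = word_eval G f u" "h2 = word_eval G f v"
        by auto
      then show ?case
        using word_eval_append[OF f] by (intro image_eqI[of _ _ "u @ v"]) auto
    qed
  qed
  moreover have "carrier G \<inter> ?T = ?T"
    using f by auto
  ultimately show ?thesis
    using h by (auto simp: group_image_def subgroup_generated_def)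
qed

end

section \<open>Evaluation of the group presentations\<close>

context projection_pair
begin

text \<open>Words of the presentations are read as composition of functions, right to left, whereas
  \<open>;\<close> composes left to right.  Sending each generator to the converse of the element it names turns
  the resulting anti-homomorphism into a homomorphism.\<close>

fun letter_value :: "tgen \<times> bool \<Rightarrow> 'a" where
  "letter_value (GA, e) = (if e then R\<^sup>\<smile> else R)"
| "letter_value (GB, e) = (if e then B\<^sup>\<smile> else B)"
| "letter_value (GC, e) = (if e then C\<^sup>\<smile> else C)"
| "letter_value (GPi, e) = (if e then \<pi>\<^sub>0\<^sup>\<smile> else \<pi>\<^sub>0)"

abbreviation group_eval :: "(tgen \<times> bool) list \<Rightarrow> 'a"
  where "group_eval \<equiv> word_eval (Pm \<AA>) letter_value"

lemma letter_value_in_Pm: "letter_value \<in> S \<times> UNIV \<rightarrow> carrier (Pm \<AA>)"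
proof (intro Pi_I)
  fix l show "letter_value l \<in> carrier (Pm \<AA>)"
    by (cases l rule: letter_value.cases) (simp_all add: Pm_def permutational_rconv
        permutational_R permutational_B permutational_C permutational_\<pi>\<^sub>0)
qed

lemma letter_value_inv: "letter_value (g, \<not> e) = inv\<^bsub>Pm \<AA>\<^esub> letter_value (g, e)"
  by (cases g) (simp_all add: inv_Pm permutational_rconv rconv_rconv
      permutational_R permutational_B permutational_C permutational_\<pi>\<^sub>0 permutational_functional)

lemma group_eval_append: "group_eval (u @ v) = group_eval u \<Zcomp> group_eval v"
  using monoid.word_eval_append[OF group.is_monoid[OF group_Pm] letter_value_in_Pm[of UNIV], of u v]
  by (simp add: Pm_def)

lemma permutational_group_eval: "permutational \<AA> (group_eval w)"
  using monoid.word_eval_closed[OF group.is_monoid[OF group_Pm] letter_value_in_Pm[of UNIV], of w]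
  by (simp add: Pm_def)

lemma group_eval_winv: "group_eval (winv w) = (group_eval w)\<^sup>\<smile>"
  using group.word_eval_winv[OF group_Pm letter_value_in_Pm[of UNIV] letter_value_inv, of w]
  by (simp add: inv_Pm permutational_group_eval)

lemma permutational_closed [simp]: "permutational \<AA> x \<Longrightarrow> x \<in> carrier \<AA>"
  by (simp add: permutational_functional)

lemma permutational_derived [simp]:
  "permutational \<AA> R" "permutational \<AA> B" "permutational \<AA> C" "permutational \<AA> \<pi>\<^sub>0"
  "permutational \<AA> X\<^sub>2" "permutational \<AA> X\<^sub>3" "permutational \<AA> C\<^sub>2" "permutational \<AA> C\<^sub>3"
  "permutational \<AA> \<pi>\<^sub>1" "permutational \<AA> \<pi>\<^sub>2" "permutational \<AA> \<pi>\<^sub>3"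
  by (simp_all add: X\<^sub>2_def X\<^sub>3_def C\<^sub>3_def \<pi>\<^sub>3_def \<pi>\<^sub>2_def \<pi>\<^sub>1_def C\<^sub>2_def permutational_rprod
      permutational_rconv permutational_R permutational_B permutational_C permutational_\<pi>\<^sub>0)

text \<open>The reversal of order by converse matches conjugation in the presentation:
  \<open>A\<^sup>-\<^sup>1BA\<close> evaluates to
  \<open>R;B\<^sup>\<smile>;R\<^sup>\<smile>\<close>, the converse of
  \<open>R;B;R\<^sup>\<smile>\<close>.\<close>

lemma group_eval_words:
  "group_eval wA = R\<^sup>\<smile>" "group_eval wB = B\<^sup>\<smile>" "group_eval wC = C\<^sup>\<smile>"
  "group_eval wX2 = X\<^sub>2\<^sup>\<smile>" "group_eval wX3 = X\<^sub>3\<^sup>\<smile>" "group_eval wC2 = C\<^sub>2\<^sup>\<smile>" "group_eval wC3 = C\<^sub>3\<^sup>\<smile>"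
  "group_eval wPi1 = \<pi>\<^sub>1\<^sup>\<smile>" "group_eval wPi2 = \<pi>\<^sub>2\<^sup>\<smile>" "group_eval wPi3 = \<pi>\<^sub>3\<^sup>\<smile>"
proof -
  have 1: "group_eval wA = R\<^sup>\<smile>" "group_eval wB = B\<^sup>\<smile>" "group_eval wC = C\<^sup>\<smile>" "group_eval wPi0 = \<pi>\<^sub>0\<^sup>\<smile>"
    by (simp_all add: wA_def wB_def wC_def wPi0_def Pm_def rprod_rid)
  have 2: "group_eval wC2 = C\<^sub>2\<^sup>\<smile>"
    by (simp add: wC2_def C\<^sub>2_def group_eval_append group_eval_winv 1
        rconv_rprod rconv_rconv rprod_right_assoc)
  have 3: "group_eval wPi1 = \<pi>\<^sub>1\<^sup>\<smile>"
    by (simp add: wPi1_def \<pi>\<^sub>1_def group_eval_append group_eval_winv 1 2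
        rconv_rprod rconv_rconv rprod_right_assoc)
  show "group_eval wA = R\<^sup>\<smile>" "group_eval wB = B\<^sup>\<smile>" "group_eval wC = C\<^sup>\<smile>"
    "group_eval wX2 = X\<^sub>2\<^sup>\<smile>" "group_eval wX3 = X\<^sub>3\<^sup>\<smile>" "group_eval wC2 = C\<^sub>2\<^sup>\<smile>" "group_eval wC3 = C\<^sub>3\<^sup>\<smile>"
    "group_eval wPi1 = \<pi>\<^sub>1\<^sup>\<smile>" "group_eval wPi2 = \<pi>\<^sub>2\<^sup>\<smile>" "group_eval wPi3 = \<pi>\<^sub>3\<^sup>\<smile>"
    by (simp_all add: 1 2 3 wX2_def wX3_def wC3_def wPi2_def wPi3_def
        X\<^sub>2_def X\<^sub>3_def C\<^sub>3_def \<pi>\<^sub>2_def \<pi>\<^sub>3_def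
        group_eval_append group_eval_winv rconv_rprod rconv_rconv rprod_right_assoc)
qed

lemma commutator_eq_rid:
  assumes "permutational \<AA> x" "permutational \<AA> y" "x \<Zcomp> y = y \<Zcomp> x"
  shows "x \<Zcomp> y \<Zcomp> x\<^sup>\<smile> \<Zcomp> y\<^sup>\<smile> = \<^bold>1'"
proof -
  have "x \<Zcomp> y \<Zcomp> x\<^sup>\<smile> \<Zcomp> y\<^sup>\<smile> = y \<Zcomp> (x \<Zcomp> x\<^sup>\<smile>) \<Zcomp> y\<^sup>\<smile>"
    using assms by (simp add: rprod_assoc)
  then show ?thesis
    using assms by (simp add: permutational_def rprod_rid)
qed

lemma wcomm_eval:
  assumes "group_eval u = x\<^sup>\<smile>" "group_eval v = y\<^sup>\<smile>"
    and "permutational \<AA> x" "permutational \<AA> y" "x \<Zcomp> y = y \<Zcomp> x"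
  shows "group_eval (wcomm u v) = \<^bold>1'"
proof -
  have "x\<^sup>\<smile> \<Zcomp> y\<^sup>\<smile> = y\<^sup>\<smile> \<Zcomp> x\<^sup>\<smile>"
    using assms(3-) by (simp flip: rconv_rprod)
  from commutator_eq_rid[OF _ _ this] show ?thesis
    using assms by (simp add: wcomm_def group_eval_append group_eval_winv permutational_rconv
        rprod_right_assoc)
qed

lemma F_relations_hold: "(u, v) \<in> F_relations \<Longrightarrow> group_eval u = group_eval v"
proof -
  have "group_eval (wA @ winv wB) = (B\<^sup>\<smile> \<Zcomp> R)\<^sup>\<smile>"
    by (simp add: group_eval_append group_eval_winv group_eval_words rconv_rprod)
  note * = wcomm_eval[OF this]
  have "group_eval (wcomm (wA @ winv wB) wX2) = \<^bold>1'" "group_eval (wcomm (wA @ winv wB) wX3) = \<^bold>1'"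
    by (rule *[OF _ _ _ group_relations(1)] *[OF _ _ _ group_relations(2)];
        simp add: group_eval_words permutational_rprod permutational_rconv)+
  then show "(u, v) \<in> F_relations \<Longrightarrow> group_eval u = group_eval v"
    by (auto simp: F_relations_def Pm_def)
qed

lemma V_relations_hold: "(u, v) \<in> V_relations \<Longrightarrow> group_eval u = group_eval v"
proof -
  \<comment> \<open>Converse reverses both sides of each verified relation, and the reversed
    products are the values of the two words of the presentation.\<close>
  note conv = arg_cong[where f = "rconv \<AA>"]
  have one: "group_eval [] = \<^bold>1'"
    by (simp add: Pm_def)
  show "(u, v) \<in> V_relations \<Longrightarrow> group_eval u = group_eval v"
    using F_relations_hold[of u v] group_relations(3-)[THEN conv]
    unfolding V_relations_def T_relations_def
    by (auto simp: group_eval_append group_eval_words one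
      rconv_rprod rconv_rid rprod_right_assoc simp del: word_eval_Nil)
qed

lemma T_relations_hold: "(u, v) \<in> T_relations \<Longrightarrow> group_eval u = group_eval v"
  by (rule V_relations_hold) (simp add: V_relations_def)

lemmas word_defs = wA_def wB_def wC_def wPi0_def wX2_def wX3_def wC2_def wC3_def wPi1_def
  wPi2_def wPi3_def winv_def wcomm_def

lemma thompson_group_images:
  "group_image (subgroup_generated (Pm \<AA>) {R, B}) thompson_F"
  "group_image (subgroup_generated (Pm \<AA>) {R, B, C}) thompson_T"
  "group_image (subgroup_generated (Pm \<AA>) {R, B, C, \<pi>\<^sub>0}) thompson_V"
proof -
  note image = group.presented_group_image[OF group_Pm letter_value_in_Pm letter_value_inv]
  have "u \<in> lists ({GA, GB} \<times> UNIV) \<and> v \<in> lists ({GA, GB} \<times> UNIV) \<and> group_eval u = group_eval v"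
    if "(u, v) \<in> F_relations" for u v
    using that F_relations_hold[OF that] by (auto simp: F_relations_def word_defs)
  from image[OF this] show "group_image (subgroup_generated (Pm \<AA>) {R, B}) thompson_F"
    by (simp add: thompson_F_def)
  have "u \<in> lists ({GA, GB, GC} \<times> UNIV) \<and> v \<in> lists ({GA, GB, GC} \<times> UNIV) \<and>
      group_eval u = group_eval v"
    if "(u, v) \<in> T_relations" for u v
    using that T_relations_hold[OF that] by (auto simp: T_relations_def F_relations_def word_defs)
  from image[OF this] show "group_image (subgroup_generated (Pm \<AA>) {R, B, C}) thompson_T"
    by (simp add: thompson_T_def)
  have "{GA, GB, GC, GPi} = UNIV"
    using tgen.exhaust by auto
  then have "u \<in> lists ({GA, GB, GC, GPi} \<times> UNIV) \<and> v \<in> lists ({GA, GB, GC, GPi} \<times> UNIV) \<and>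
      group_eval u = group_eval v"
    if "(u, v) \<in> V_relations" for u v
    using V_relations_hold[OF that] by simp
  from image[OF this] show "group_image (subgroup_generated (Pm \<AA>) {R, B, C, \<pi>\<^sub>0}) thompson_V"
    by (simp add: thompson_V_def)
qed

section \<open>Thompson's monoid\<close>

lemma PR_relations:
  "P \<Zcomp> P = \<^bold>1'"
  "(P \<Zcomp> R) \<Zcomp> (P \<Zcomp> R) \<Zcomp> (P \<Zcomp> R) = \<^bold>1'"
  "(R \<Zcomp> P) \<Zcomp> (R \<Zcomp> P) \<Zcomp> (R \<Zcomp> P) = \<^bold>1'"
  by ((simp add: tables; fail) | rule functional_eqI)+

text \<open>The inverse that \<open>(P;R)^3 = 1'\<close> and \<open>P;P = 1'\<close> dictate. It
  places \<open>R\<^sup>\<smile>\<close> in the submonoid generated by \<open>P\<close> and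
  \<open>R\<close>.\<close>

lemma R_conv_eq: "R\<^sup>\<smile> = P \<Zcomp> (R \<Zcomp> (P \<Zcomp> (R \<Zcomp> P)))"
  by ((simp add: tables; fail) | rule functional_eqI)+

text \<open>Duplicate, then act on both copies. Pairing thus becomes a product of deferments, and
  the laws of the monoid for arbitrary \<open>x\<close> become statements about
  \<open>fork x x\<close>.\<close>

lemma fork_eq_U: "\<lbrakk>functional \<AA> x; functional \<AA> y\<rbrakk> \<Longrightarrow> fork x y = U \<Zcomp> defer\<^sub>0 x \<Zcomp> defer\<^sub>1 y"
  by (simp add: U_def fork_defer\<^sub>0 fork_defer\<^sub>1 rid_rprod)

lemma functional_rprod_U: "functional \<AA> x \<Longrightarrow> x \<Zcomp> U = U \<Zcomp> defer\<^sub>0 x \<Zcomp> defer\<^sub>1 x"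
  using fork_eq_U[of x x] by (simp add: U_def functional_rprod_fork rprod_rid)

lemma functional_reassemble:
  assumes "functional \<AA> x"
  shows "x = U \<Zcomp> defer\<^sub>0 x \<Zcomp> defer\<^sub>1 x \<Zcomp> defer\<^sub>0 a \<Zcomp> defer\<^sub>1 b"
  using assms by (simp flip: fork_eq_U add: fork_defer\<^sub>0 fork_defer\<^sub>1 fork_surjective)

text \<open>\<open>U\<^sup>\<smile>\<close> is the meet of the two projections, the partial map
  taking \<open>(s,s)\<close> to \<open>s\<close>. The tables for total elements do not apply; it
  lies below \<open>a\<close>, and \<open>U;a = 1'\<close>.\<close>

lemma functional_rconv_U: "functional \<AA> (U\<^sup>\<smile>)"
proof (rule functionalI)
  have "U\<^sup>\<smile> \<preceq> a"
    using meet_le1[of a b] by (simp add: U_def fork_def rid_rprod rconv_bprod rconv_rconv)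
  then have "U \<Zcomp> U\<^sup>\<smile> \<preceq> U \<Zcomp> a"
    by (intro rprod_le_right) auto
  then show "U\<^sup>\<smile>\<^sup>\<smile> \<Zcomp> U\<^sup>\<smile> \<preceq> \<^bold>1'"
    by (simp add: rconv_rconv table_U)
qed auto

lemma defer\<^sub>1_eq: "total_fn x \<Longrightarrow> defer\<^sub>1 x = P \<Zcomp> (defer\<^sub>0 x \<Zcomp> P)"
  by ((simp add: tables; fail) | rule functional_eqI)+

text \<open>For the first equation, \<open>((p,q),r)\<close> passes through
  \<open>(p,(q,r))\<close>, \<open>((q,r),p)\<close>, \<open>(q,(r,p))\<close> and
  \<open>(r,p)\<close> to \<open>(p,r)\<close>.\<close>

lemma defer\<^sub>0_eqs:
  "defer\<^sub>0 a = R\<^sup>\<smile> \<Zcomp> (P \<Zcomp> (R\<^sup>\<smile> \<Zcomp> (b \<Zcomp> P)))"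
  "defer\<^sub>0 b = R\<^sup>\<smile> \<Zcomp> b"
  "defer\<^sub>0 U = U \<Zcomp> (defer\<^sub>0 a \<Zcomp> R)"
  by ((simp add: tables; fail) | rule functional_eqI)+

text \<open>Rebracketing \<open>((p,q),r)\<close> to \<open>(p,(q,r))\<close> brings
  \<open>p\<close> to the first component, where a single deferment reaches it.\<close>

lemma defer\<^sub>0_defer\<^sub>0: "total_fn x \<Longrightarrow> defer\<^sub>0 (defer\<^sub>0 x) = R\<^sup>\<smile> \<Zcomp> (defer\<^sub>0 x \<Zcomp> R)"
  by ((simp add: tables; fail) | rule functional_eqI)+

text \<open>On \<open>((p, q), r)\<close> the word takes \<open>q\<close> from a first copy and \<open>p\<close> and \<open>r\<close> from a second one:
  \<open>P\<close> and \<open>R\<close> alone preserve the cyclic order of the components.\<close>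

lemma defer\<^sub>0_P_eq:
  "defer\<^sub>0 P = U \<Zcomp> (defer\<^sub>0 a \<Zcomp> (defer\<^sub>0 b \<Zcomp> (P \<Zcomp> (R\<^sup>\<smile> \<Zcomp> (defer\<^sub>0 a \<Zcomp> (R \<Zcomp> (P \<Zcomp> R)))))))"
  by ((simp add: tables; fail) | rule functional_eqI)+

lemma submonoid_generated_PR:
  "submonoid_generated (Fn \<AA>) {defer\<^sub>0 P, defer\<^sub>0 R, a, U} = submonoid_generated (Fn \<AA>) {P, R, a, U}"
proof -
  interpret Fn: Group.monoid "Fn \<AA>" by (rule monoid_Fn)
  let ?G = "\<lambda>S. carrier (submonoid_generated (Fn \<AA>) S)"
  have closed: "x \<Zcomp> y \<in> ?G S" if "x \<in> ?G S" "y \<in> ?G S" for x y S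
    using submonoid.m_closed[OF Fn.submonoid_submonoid_generated that] by (simp add: Fn_def)
  have incl: "x \<in> ?G S" if "x \<in> S" "total_fn x" for x S
    using that by (intro Fn.submonoid_generated_incl) (simp_all add: Fn_def)
  let ?S = "{defer\<^sub>0 P, defer\<^sub>0 R, a, U}"
  \<comment> \<open>\<open>U;x\<^sub>0;a\<close> undoes the deferment: the argument is duplicated,
    \<open>x\<close> acts on one copy, and the other copy is discarded.\<close>
  have "U \<Zcomp> (defer\<^sub>0 P \<Zcomp> a) \<in> ?G ?S" "U \<Zcomp> (defer\<^sub>0 R \<Zcomp> a) \<in> ?G ?S"
    by (intro closed incl; simp)+
  then have "{P, R, a, U} \<subseteq> ?G ?S"
    by (auto simp: tables intro!: incl)
  then have 1: "?G {P, R, a, U} \<subseteq> ?G ?S"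
    by (intro Fn.submonoid_generated_minimal Fn.submonoid_submonoid_generated)
  let ?T = "{P, R, a, U}"
  have g: "P \<in> ?G ?T" "R \<in> ?G ?T" "a \<in> ?G ?T" "U \<in> ?G ?T"
    by (intro incl; simp)+
  have "P \<Zcomp> a \<in> ?G ?T"
    by (intro closed g)
  then have b: "b \<in> ?G ?T"
    by (simp add: tables)
  have Ri: "R\<^sup>\<smile> \<in> ?G ?T"
    unfolding R_conv_eq by (intro closed g)
  have K: "defer\<^sub>0 a \<in> ?G ?T" and L: "defer\<^sub>0 b \<in> ?G ?T"
    unfolding defer\<^sub>0_eqs by (intro closed g b Ri)+
  have P: "defer\<^sub>0 P \<in> ?G ?T"
    unfolding defer\<^sub>0_P_eq by (intro closed g Ri K L)
  \<comment> \<open>A deferred fork involves \<open>x\<close> and \<open>y\<close> deferred twice,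
    which conjugation by \<open>R\<close> reduces to one deferment. It also involves
    \<open>defer\<^sub>0 P\<close> itself, so treating \<open>P\<close> as the fork of
    \<open>b\<close> and \<open>a\<close> would be circular; this is why
    \<open>defer\<^sub>0_P_eq\<close> supplies a separate word.\<close>
  have fork: "defer\<^sub>0 (fork x y) \<in> ?G ?T"
    if "defer\<^sub>0 x \<in> ?G ?T" "defer\<^sub>0 y \<in> ?G ?T" "total_fn x" "total_fn y" for x y
  proof -
    have "defer\<^sub>0 (fork x y) = defer\<^sub>0 U \<Zcomp> defer\<^sub>0 (defer\<^sub>0 x) \<Zcomp> (defer\<^sub>0 P \<Zcomp> (defer\<^sub>0 (defer\<^sub>0 y) \<Zcomp> defer\<^sub>0 P))"
      using that(3,4) by (simp add: fork_eq_U defer_rprod defer\<^sub>1_eq)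
    also have "\<dots> \<in> ?G ?T"
      unfolding defer\<^sub>0_defer\<^sub>0[OF that(3)] defer\<^sub>0_defer\<^sub>0[OF that(4)] defer\<^sub>0_eqs(3)
      by (intro closed g Ri K P that)
    finally show ?thesis .
  qed
  have "defer\<^sub>0 (fork (fork a (b \<Zcomp> a)) (b \<Zcomp> b)) \<in> ?G ?T"
    by (intro fork) (simp_all add: defer_rprod closed K L)
  then have "defer\<^sub>0 R \<in> ?G ?T"
    by (simp flip: R_def)
  with P g have "?S \<subseteq> ?G ?T"
    by simp
  then have "?G ?S \<subseteq> ?G ?T"
    by (intro Fn.submonoid_generated_minimal Fn.submonoid_submonoid_generated)
  with 1 have "?G ?S = ?G ?T"
    by auto
  then show ?thesis
    by (metis submonoid_generated_carrier)
qed

fun generator_value :: "mgen \<Rightarrow> 'a" where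
  "generator_value gK = a"
| "generator_value gL = b"
| "generator_value gU = U"
| "generator_value gP0 = defer\<^sub>0 P"
| "generator_value gR0 = defer\<^sub>0 R"

abbreviation monoid_eval :: "mgen list \<Rightarrow> 'a"
  where "monoid_eval \<equiv> word_eval (Fn \<AA>) generator_value"

lemma monoid_eval_simps:
  "monoid_eval [] = \<^bold>1'" "monoid_eval (g # w) = generator_value g \<Zcomp> monoid_eval w"
  by (simp_all add: Fn_def)

lemma total_generator_value [simp]: "total_fn (generator_value g)"
  by (cases g) simp_all

lemma generator_value_in_Fn: "generator_value \<in> UNIV \<rightarrow> carrier (Fn \<AA>)"
  by (simp add: Fn_def)

lemma total_monoid_eval [simp]: "total_fn (monoid_eval w)"
  by (induction w) (simp_all add: monoid_eval_simps del: word_eval_Nil word_eval_Cons)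

lemma monoid_eval_append: "monoid_eval (u @ v) = monoid_eval u \<Zcomp> monoid_eval v"
  using monoid.word_eval_append[OF monoid_Fn generator_value_in_Fn, of u v] by (simp add: Fn_def)

lemma monoid_eval_words: "monoid_eval mP = P" "monoid_eval mR = R" "monoid_eval mRi = R\<^sup>\<smile>"
proof -
  show *: "monoid_eval mP = P" "monoid_eval mR = R"
    by (simp_all add: mP_def mR_def monoid_eval_simps tables del: word_eval_Nil word_eval_Cons)
  show "monoid_eval mRi = R\<^sup>\<smile>"
    by (simp add: mRi_def monoid_eval_append * R_conv_eq)
qed

lemma monoid_eval_gdefer0: "monoid_eval (gdefer0 g) = defer\<^sub>0 (generator_value g)"
proof -
  have K: "monoid_eval mK0 = defer\<^sub>0 a"
    by (simp add: mK0_def monoid_eval_append monoid_eval_words monoid_eval_simps rprod_rid defer\<^sub>0_eqs(1)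
        del: word_eval_Nil word_eval_Cons)
  show ?thesis
    by (cases g) (simp_all add: K defer\<^sub>0_eqs(2,3) defer\<^sub>0_defer\<^sub>0 monoid_eval_append monoid_eval_words
        monoid_eval_simps rprod_rid rprod_right_assoc del: word_eval_Nil word_eval_Cons append.simps)
qed

text \<open>This makes the relations obtained by iterated deferment hold: equal values of two words
  yield equal values of the deferred words.\<close>

lemma monoid_eval_defer0: "monoid_eval (defer0 w) = defer\<^sub>0 (monoid_eval w)"
proof (induction w)
  case (Cons g w)
  then show ?case
    by (simp add: defer0_def monoid_eval_append monoid_eval_gdefer0 monoid_eval_simps defer_rprod
        del: word_eval_Nil word_eval_Cons)
qed (simp add: defer0_def monoid_eval_simps defer_rid del: word_eval_Nil)

lemma monoid_eval_defer1: "monoid_eval (defer1 w) = defer\<^sub>1 (monoid_eval w)"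
  by (simp add: defer1_def monoid_eval_append monoid_eval_defer0 monoid_eval_words defer\<^sub>1_eq)

lemma deferred_generator_relations:
  "U \<Zcomp> a = \<^bold>1'" "U \<Zcomp> b = \<^bold>1'"
  "defer\<^sub>0 P \<Zcomp> a \<Zcomp> a = a \<Zcomp> b" "defer\<^sub>0 P \<Zcomp> a \<Zcomp> b = a \<Zcomp> a" "defer\<^sub>0 P \<Zcomp> b = b"
  "defer\<^sub>0 R \<Zcomp> a \<Zcomp> a \<Zcomp> a = a \<Zcomp> a" "defer\<^sub>0 R \<Zcomp> a \<Zcomp> a \<Zcomp> b = a \<Zcomp> b \<Zcomp> a"
  "defer\<^sub>0 R \<Zcomp> a \<Zcomp> b = a \<Zcomp> b \<Zcomp> b" "defer\<^sub>0 R \<Zcomp> b = b"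
  by (simp_all add: tables)

lemma M_schemes_hold:
  assumes "(u, v) \<in> M_schemes"
  shows "monoid_eval u = monoid_eval v"
proof -
  have U: "monoid_eval [gU] = U" and K: "monoid_eval [gK] = a" and L: "monoid_eval [gL] = b"
    by (simp_all add: monoid_eval_simps rprod_rid del: word_eval_Nil word_eval_Cons)
  show ?thesis
    using assms unfolding M_schemes_def
  proof (elim UnE)
    assume "(u, v) \<in> {(mP @ mP, []), ((mP @ mR) @ (mP @ mR) @ (mP @ mR), []),
        ((mR @ mP) @ (mR @ mP) @ (mR @ mP), [])}"
    then show ?thesis
      using PR_relations by (auto simp: monoid_eval_append monoid_eval_words monoid_eval_simps
          rprod_right_assoc simp del: word_eval_Nil)
  next
    assume "(u, v) \<in> {(defer0 x @ defer1 y, defer1 y @ defer0 x) | x y. True}"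
    then show ?thesis
      by (auto simp: monoid_eval_append monoid_eval_defer0 monoid_eval_defer1 defer_commute)
  next
    assume "(u, v) \<in> {(x @ [gU], [gU] @ defer0 x @ defer1 x) | x. True}"
    then obtain x where "u = x @ [gU]" "v = [gU] @ defer0 x @ defer1 x"
      by auto
    then show ?thesis
      using functional_rprod_U[of "monoid_eval x"]
      by (simp add: monoid_eval_append monoid_eval_defer0 monoid_eval_defer1 U rprod_right_assoc
          del: word_eval_Cons append.simps)
  next
    assume "(u, v) \<in> {(x, [gU] @ defer0 x @ defer1 x @ defer0 [gK] @ defer1 [gL]) | x. True}"
    then have "v = [gU] @ defer0 u @ defer1 u @ defer0 [gK] @ defer1 [gL]"
      by auto
    then show ?thesis
      using functional_reassemble[of "monoid_eval u"]
      by (simp add: monoid_eval_append monoid_eval_defer0 monoid_eval_defer1 U K L rprod_right_assoc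
          del: word_eval_Cons append.simps)
  next
    assume "(u, v) \<in> {([gU, gK], []), ([gU, gL], []), ([gP0, gK, gK], [gK, gL]),
        ([gP0, gK, gL], [gK, gK]), ([gP0, gL], [gL]), ([gR0, gK, gK, gK], [gK, gK]),
        ([gR0, gK, gK, gL], [gK, gL, gK]), ([gR0, gK, gL], [gK, gL, gL]), ([gR0, gL], [gL])}"
    then show ?thesis
      by (auto simp: monoid_eval_simps tables simp del: word_eval_Nil word_eval_Cons)
  qed
qed

lemma M_relations_hold: "(u, v) \<in> M_relations \<Longrightarrow> monoid_eval u = monoid_eval v"
proof (induction "(u, v)" arbitrary: u v rule: M_relations.induct)
  case scheme
  then show ?case by (rule M_schemes_hold)
next
  case (deferred u v)
  then show ?case by (simp add: monoid_eval_defer0)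
qed

lemma thompson_M_image:
  "monoid_image (submonoid_generated (Fn \<AA>) {defer\<^sub>0 P, defer\<^sub>0 R, a, U}) thompson_M"
proof -
  interpret Fn: Group.monoid "Fn \<AA>" by (rule monoid_Fn)
  let ?S = "{defer\<^sub>0 P, defer\<^sub>0 R, a, U}"
  let ?G = "carrier (submonoid_generated (Fn \<AA>) ?S)"
  have closed: "x \<Zcomp> y \<in> ?G" if "x \<in> ?G" "y \<in> ?G" for x y
    using submonoid.m_closed[OF Fn.submonoid_submonoid_generated that] by (simp add: Fn_def)
  have incl: "x \<in> ?G" if "x \<in> ?S" for x
    using that by (intro Fn.submonoid_generated_incl) (auto simp: Fn_def)
  \<comment> \<open>\<open>L\<close> is a generator of the presentation but not of this submonoid.
    It is recovered as \<open>P;a\<close>, with \<open>P\<close> obtained from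
    \<open>defer\<^sub>0 P\<close>.\<close>
  have "U \<Zcomp> (defer\<^sub>0 P \<Zcomp> a) \<Zcomp> a \<in> ?G"
    by (intro closed incl) simp_all
  then have "b \<in> ?G"
    by (simp add: tables)
  then have gen: "generator_value g \<in> ?G" for g
    by (cases g) (simp_all add: incl)
  have "monoid_eval w \<in> ?G" for w
  proof (induction w)
    case Nil
    show ?case
      using submonoid.one_closed[OF Fn.submonoid_submonoid_generated] by simp
  next
    case (Cons g w)
    with gen[of g] show ?case
      unfolding monoid_eval_simps by (rule closed)
  qed
  moreover have "?G \<subseteq> range monoid_eval"
  proof (rule Fn.submonoid_generated_minimal)
    have "monoid_eval u \<otimes>\<^bsub>Fn \<AA>\<^esub> monoid_eval v = monoid_eval (u @ v)" for u v
      unfolding monoid_eval_append by (simp add: Fn_def)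
    moreover have "\<one>\<^bsub>Fn \<AA>\<^esub> \<in> range monoid_eval"
      using rangeI[of monoid_eval "[]"] by simp
    moreover have "range monoid_eval \<subseteq> carrier (Fn \<AA>)"
      using Fn.word_eval_closed[OF generator_value_in_Fn] by auto
    ultimately show "submonoid (range monoid_eval) (Fn \<AA>)"
      by unfold_locales (blast, auto)
    have "generator_value g = monoid_eval [g]" for g
      by (simp add: monoid_eval_simps rprod_rid del: word_eval_Nil word_eval_Cons)
    then show "?S \<subseteq> range monoid_eval"
      by (metis (no_types, opaque_lifting) generator_value.simps empty_subsetI insert_subset rangeI)
  qed
  ultimately have "?G = range monoid_eval"
    by auto
  then have "submonoid_generated (Fn \<AA>) ?S = (Fn \<AA>)\<lparr>carrier := monoid_eval ` lists UNIV\<rparr>"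
    using submonoid_generated_carrier[of "Fn \<AA>" ?S] by simp
  then show ?thesis
    using Fn.presented_monoid_epi[OF generator_value_in_Fn, of M_relations] M_relations_hold
    by (simp add: monoid_image_def thompson_M_def)
qed

end

section \<open>The nine claims together\<close>

theorem theorem33:
  fixes \<AA> :: "('a, 'm) j_alg_scheme" (structure)
    and bsum :: "'a \<Rightarrow> 'a \<Rightarrow> 'a" and bcompl :: "'a \<Rightarrow> 'a"
    and a b K L U P P\<^sub>0 R R\<^sub>0 A B C \<pi>\<^sub>0 X\<^sub>2 X\<^sub>3 C\<^sub>2 C\<^sub>3 \<pi>\<^sub>1 \<pi>\<^sub>2 \<pi>\<^sub>3 :: 'a
    and comm :: "'a \<Rightarrow> 'a \<Rightarrow> 'a" and d\<^sub>0 d\<^sub>1 :: "'a \<Rightarrow> 'a"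
  assumes alg: "j_algebra \<AA> \<or> relation_algebra \<AA> bsum bcompl"
    and ab: "a \<in> carrier \<AA>" "b \<in> carrier \<AA>"
    and id_eqs: "\<^bold>1' = a\<^sup>\<smile> \<Zcomp> a" "\<^bold>1' = b\<^sup>\<smile> \<Zcomp> b" "\<^bold>1' = a \<Zcomp> a\<^sup>\<smile> \<cdot> b \<Zcomp> b\<^sup>\<smile>"
    and unit_eqs: "\<^bold>1 = a\<^sup>\<smile> \<Zcomp> b" "\<^bold>1 = a \<Zcomp> \<^bold>1" "\<^bold>1 = b \<Zcomp> \<^bold>1"
    and K_def: "K = a"
    and L_def: "L = b"
    and U_def: "U = a\<^sup>\<smile> \<cdot> b\<^sup>\<smile>"
    and P_def: "P = a \<Zcomp> b\<^sup>\<smile> \<cdot> b \<Zcomp> a\<^sup>\<smile>"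
    and P0_def: "P\<^sub>0 = a \<Zcomp> P \<Zcomp> a\<^sup>\<smile> \<cdot> b \<Zcomp> b\<^sup>\<smile>"
    and R_def: "R = a \<Zcomp> (a\<^sup>\<smile> \<Zcomp> a\<^sup>\<smile>) \<cdot> b \<Zcomp> a \<Zcomp> b\<^sup>\<smile> \<Zcomp> a\<^sup>\<smile> \<cdot> (b \<Zcomp> b) \<Zcomp> b\<^sup>\<smile>"
    and R0_def: "R\<^sub>0 = a \<Zcomp> R \<Zcomp> a\<^sup>\<smile> \<cdot> b \<Zcomp> b\<^sup>\<smile>"
    and A_def: "A = R"
    and B_def: "B = a \<Zcomp> a\<^sup>\<smile> \<cdot> b \<Zcomp> A \<Zcomp> b\<^sup>\<smile>"
    and C_def: "C = a \<Zcomp> (b\<^sup>\<smile> \<Zcomp> b\<^sup>\<smile>) \<cdot> b \<Zcomp> a \<Zcomp> a\<^sup>\<smile> \<cdot> (b \<Zcomp> b) \<Zcomp> a\<^sup>\<smile> \<Zcomp> b\<^sup>\<smile>"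
    and pi0_def: "\<pi>\<^sub>0 = a \<Zcomp> a\<^sup>\<smile> \<Zcomp> b\<^sup>\<smile> \<cdot> b \<Zcomp> a \<Zcomp> a\<^sup>\<smile> \<cdot> (b \<Zcomp> b) \<Zcomp> (b\<^sup>\<smile> \<Zcomp> b\<^sup>\<smile>)"
    and X2_def: "X\<^sub>2 = A \<Zcomp> B \<Zcomp> A\<^sup>\<smile>"
    and X3_def: "X\<^sub>3 = (A \<Zcomp> A) \<Zcomp> B \<Zcomp> (A\<^sup>\<smile> \<Zcomp> A\<^sup>\<smile>)"
    and C2_def: "C\<^sub>2 = B \<Zcomp> C \<Zcomp> A\<^sup>\<smile>"
    and C3_def: "C\<^sub>3 = (B \<Zcomp> B) \<Zcomp> C \<Zcomp> (A\<^sup>\<smile> \<Zcomp> A\<^sup>\<smile>)"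
    and pi1_def: "\<pi>\<^sub>1 = C\<^sub>2 \<Zcomp> \<pi>\<^sub>0 \<Zcomp> C\<^sub>2\<^sup>\<smile>"
    and pi2_def: "\<pi>\<^sub>2 = A \<Zcomp> \<pi>\<^sub>1 \<Zcomp> A\<^sup>\<smile>"
    and pi3_def: "\<pi>\<^sub>3 = (A \<Zcomp> A) \<Zcomp> \<pi>\<^sub>1 \<Zcomp> (A\<^sup>\<smile> \<Zcomp> A\<^sup>\<smile>)"
    and comm_def: "comm = (\<lambda>x y. x \<Zcomp> y \<Zcomp> x\<^sup>\<smile> \<Zcomp> y\<^sup>\<smile>)"
    and d0_def: "d\<^sub>0 = (\<lambda>x. a \<Zcomp> x \<Zcomp> a\<^sup>\<smile> \<cdot> b \<Zcomp> b\<^sup>\<smile>)"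
    and d1_def: "d\<^sub>1 = (\<lambda>x. a \<Zcomp> a\<^sup>\<smile> \<cdot> b \<Zcomp> x \<Zcomp> b\<^sup>\<smile>)"
  shows
   "\<comment> \<open>(i)\<close>
    (functional \<AA> K \<and> functional \<AA> L \<and> functional \<AA> U \<and> functional \<AA> (U\<^sup>\<smile>)) \<and>
    \<comment> \<open>(ii)\<close>
    (permutational \<AA> P \<and> permutational \<AA> P\<^sub>0 \<and> permutational \<AA> R \<and> permutational \<AA> R\<^sub>0 \<and>
     permutational \<AA> A \<and> permutational \<AA> B \<and> permutational \<AA> C \<and> permutational \<AA> \<pi>\<^sub>0) \<and>
    \<comment> \<open>(iii)\<close>
    (comm (B\<^sup>\<smile> \<Zcomp> A) X\<^sub>2 = \<^bold>1' \<and>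
     comm (B\<^sup>\<smile> \<Zcomp> A) X\<^sub>3 = \<^bold>1' \<and>
     C = C\<^sub>2 \<Zcomp> B \<and>
     X\<^sub>2 \<Zcomp> C\<^sub>2 = C\<^sub>3 \<Zcomp> B \<and>
     A \<Zcomp> C = C\<^sub>2 \<Zcomp> C\<^sub>2 \<and>
     C \<Zcomp> C \<Zcomp> C = \<^bold>1' \<and>
     \<pi>\<^sub>1 \<Zcomp> \<pi>\<^sub>1 = \<^bold>1' \<and>
     \<pi>\<^sub>3 \<Zcomp> \<pi>\<^sub>1 = \<pi>\<^sub>1 \<Zcomp> \<pi>\<^sub>3 \<and>
     (\<pi>\<^sub>1 \<Zcomp> \<pi>\<^sub>2) \<Zcomp> (\<pi>\<^sub>1 \<Zcomp> \<pi>\<^sub>2) \<Zcomp> (\<pi>\<^sub>1 \<Zcomp> \<pi>\<^sub>2) = \<^bold>1' \<and>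
     \<pi>\<^sub>1 \<Zcomp> X\<^sub>3 = X\<^sub>3 \<Zcomp> \<pi>\<^sub>1 \<and>
     X\<^sub>2 \<Zcomp> \<pi>\<^sub>1 = \<pi>\<^sub>1 \<Zcomp> \<pi>\<^sub>2 \<Zcomp> B \<and>
     B \<Zcomp> \<pi>\<^sub>2 = \<pi>\<^sub>3 \<Zcomp> B \<and>
     C\<^sub>3 \<Zcomp> \<pi>\<^sub>1 = \<pi>\<^sub>2 \<Zcomp> C\<^sub>3 \<and>
     (C\<^sub>2 \<Zcomp> \<pi>\<^sub>1) \<Zcomp> (C\<^sub>2 \<Zcomp> \<pi>\<^sub>1) \<Zcomp> (C\<^sub>2 \<Zcomp> \<pi>\<^sub>1) = \<^bold>1') \<and>
    \<comment> \<open>(iv)\<close>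
    group_image (subgroup_generated (Pm \<AA>) {A, B}) thompson_F \<and>
    \<comment> \<open>(v)\<close>
    group_image (subgroup_generated (Pm \<AA>) {A, B, C}) thompson_T \<and>
    \<comment> \<open>(vi)\<close>
    group_image (subgroup_generated (Pm \<AA>) {A, B, C, \<pi>\<^sub>0}) thompson_V \<and>
    \<comment> \<open>(vii)\<close>
    submonoid_generated (Fn \<AA>) {P\<^sub>0, R\<^sub>0, K, U} = submonoid_generated (Fn \<AA>) {P, R, K, U} \<and>
    \<comment> \<open>(viii)\<close>
    (P \<Zcomp> P = \<^bold>1' \<and>
     (P \<Zcomp> R) \<Zcomp> (P \<Zcomp> R) \<Zcomp> (P \<Zcomp> R) = \<^bold>1' \<and>
     (R \<Zcomp> P) \<Zcomp> (R \<Zcomp> P) \<Zcomp> (R \<Zcomp> P) = \<^bold>1' \<and>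
     (\<forall>x \<in> carrier (Fn \<AA>). d\<^sub>0 x \<in> carrier (Fn \<AA>) \<and> d\<^sub>1 x \<in> carrier (Fn \<AA>)) \<and>
     (\<forall>x \<in> carrier (Fn \<AA>). \<forall>y \<in> carrier (Fn \<AA>). d\<^sub>0 x \<Zcomp> d\<^sub>1 y = d\<^sub>1 y \<Zcomp> d\<^sub>0 x) \<and>
     (\<forall>x \<in> carrier (Fn \<AA>). x \<Zcomp> U = U \<Zcomp> d\<^sub>0 x \<Zcomp> d\<^sub>1 x) \<and>
     (\<forall>x \<in> carrier (Fn \<AA>). x = U \<Zcomp> d\<^sub>0 x \<Zcomp> d\<^sub>1 x \<Zcomp> d\<^sub>0 K \<Zcomp> d\<^sub>1 L) \<and>
     U \<Zcomp> K = \<^bold>1' \<and>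
     U \<Zcomp> L = \<^bold>1' \<and>
     P\<^sub>0 \<Zcomp> K \<Zcomp> K = K \<Zcomp> L \<and>
     P\<^sub>0 \<Zcomp> K \<Zcomp> L = K \<Zcomp> K \<and>
     P\<^sub>0 \<Zcomp> L = L \<and>
     R\<^sub>0 \<Zcomp> K \<Zcomp> K \<Zcomp> K = K \<Zcomp> K \<and>
     R\<^sub>0 \<Zcomp> K \<Zcomp> K \<Zcomp> L = K \<Zcomp> L \<Zcomp> K \<and>
     R\<^sub>0 \<Zcomp> K \<Zcomp> L = K \<Zcomp> L \<Zcomp> L \<and>
     R\<^sub>0 \<Zcomp> L = L) \<and>
    \<comment> \<open>(ix)\<close>
    monoid_image (submonoid_generated (Fn \<AA>) {P\<^sub>0, R\<^sub>0, K, U}) thompson_M"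
proof -
  have "j_algebra \<AA>"
    using alg relation_algebra.is_j_algebra by blast
  then interpret j_algebra \<AA> .
  interpret pp: projection_pair \<AA> a b
    using ab id_eqs unit_eqs by unfold_locales simp_all
  have d: "d\<^sub>0 = pp.defer\<^sub>0" "d\<^sub>1 = pp.defer\<^sub>1"
    by (simp_all add: fun_eq_iff d0_def d1_def pp.defer\<^sub>0_def pp.defer\<^sub>1_def pp.fork_def)
  \<comment> \<open>The given formula for \<open>R\<close> is the flattened nested fork; the one for
    \<open>P\<close> lists the two factors of its fork in the opposite order.\<close>
  have UPR: "U = pp.U" "P = pp.P" "R = pp.R"
    by (simp_all add: U_def P_def R_def pp.U_def pp.P_def pp.R_def pp.fork_fork_left
        rid_rprod rprod_right_assoc) (simp_all add: pp.fork_def rid_rprod bprod_comm)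
  have C: "C = pp.C" "\<pi>\<^sub>0 = pp.\<pi>\<^sub>0"
    by (simp_all add: C_def pi0_def pp.C_def pp.\<pi>\<^sub>0_def pp.fork_fork_right rprod_right_assoc bprod_ac)
  have D: "P\<^sub>0 = pp.defer\<^sub>0 pp.P" "R\<^sub>0 = pp.defer\<^sub>0 pp.R" "B = pp.B"
    using P0_def R0_def B_def by (simp_all flip: d add: d0_def d1_def pp.B_def A_def UPR)
  note eqs = K_def L_def A_def d UPR C D
  have X: "X\<^sub>2 = pp.X\<^sub>2" "X\<^sub>3 = pp.X\<^sub>3" "C\<^sub>2 = pp.C\<^sub>2" "C\<^sub>3 = pp.C\<^sub>3"
    by (simp_all add: eqs X2_def X3_def C2_def C3_def pp.X\<^sub>2_def pp.X\<^sub>3_def pp.C\<^sub>2_def pp.C\<^sub>3_def)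
  have \<pi>: "\<pi>\<^sub>1 = pp.\<pi>\<^sub>1"
    by (simp add: eqs X pi1_def pp.\<pi>\<^sub>1_def)
  have \<pi>': "\<pi>\<^sub>2 = pp.\<pi>\<^sub>2" "\<pi>\<^sub>3 = pp.\<pi>\<^sub>3"
    by (simp_all add: eqs \<pi> pi2_def pi3_def pp.\<pi>\<^sub>2_def pp.\<pi>\<^sub>3_def)
  have comm: "comm (pp.B\<^sup>\<smile> \<Zcomp> pp.R) pp.X\<^sub>2 = \<^bold>1'" "comm (pp.B\<^sup>\<smile> \<Zcomp> pp.R) pp.X\<^sub>3 = \<^bold>1'"
    using pp.commutator_eq_rid[OF _ _ pp.group_relations(1)]
      pp.commutator_eq_rid[OF _ _ pp.group_relations(2)]
    by (simp_all add: comm_def permutational_rprod permutational_rconv)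
  have carrier_Fn: "carrier (Fn \<AA>) = {x. functional \<AA> x}"
    by (simp add: Fn_def)
  have "\<forall>x \<in> carrier (Fn \<AA>). pp.defer\<^sub>0 x \<in> carrier (Fn \<AA>) \<and> pp.defer\<^sub>1 x \<in> carrier (Fn \<AA>)"
    by (simp add: carrier_Fn)
  moreover have "\<forall>x \<in> carrier (Fn \<AA>). \<forall>y \<in> carrier (Fn \<AA>).
      pp.defer\<^sub>0 x \<Zcomp> pp.defer\<^sub>1 y = pp.defer\<^sub>1 y \<Zcomp> pp.defer\<^sub>0 x"
    by (simp add: carrier_Fn pp.defer_commute)
  moreover have "\<forall>x \<in> carrier (Fn \<AA>). x \<Zcomp> pp.U = pp.U \<Zcomp> pp.defer\<^sub>0 x \<Zcomp> pp.defer\<^sub>1 x"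
    by (simp add: carrier_Fn pp.functional_rprod_U)
  moreover have "\<forall>x \<in> carrier (Fn \<AA>).
      x = pp.U \<Zcomp> pp.defer\<^sub>0 x \<Zcomp> pp.defer\<^sub>1 x \<Zcomp> pp.defer\<^sub>0 a \<Zcomp> pp.defer\<^sub>1 b"
    unfolding carrier_Fn by (intro ballI pp.functional_reassemble) simp
  moreover have "functional \<AA> a" "functional \<AA> b" "functional \<AA> pp.U"
    by simp_all
  ultimately show ?thesis
    unfolding eqs X \<pi> \<pi>'
    by (intro conjI comm pp.functional_rconv_U
        pp.permutational_P pp.permutational_derived pp.permutational_defer
        pp.group_relations pp.thompson_group_images pp.submonoid_generated_PR pp.PR_relations
        pp.deferred_generator_relations pp.thompson_M_image)
qed

end
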